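(* Let $F$ be a field of characteristic $0$ and let $H$ be a finite dimensional (co)semisimple Hopf algebra over $F$. Let $L$ be an $H$-module (respectively, $H$-comodule) Lie algebra over $F$, and let $(V,\psi)$ be a finite dimensional $(H,L)$-module, in the corresponding sense, that is completely reducible as an $L$-module disregarding the $H$-action (respectively, $H$-coaction). Then $V=V_1\oplus V_2\oplus\dots\oplus V_s$ for some irreducible $(H,L)$-submodules $V_i$.
   Context: For a finite dimensional Hopf algebra over a field of characteristic $0$, semisimplicity and cosemisimplicity are equivalent (Larson--Radford); "(co)semisimple" means that these equivalent conditions hold. Sweedler notation: $\Delta(h)=h_{(1)}\otimes h_{(2)}$ for the comultiplication, $\rho(v)=v_{(0)}\otimes v_{(1)}$ for right $H$-coactions. Module version: a Lie algebra $L$ that is a left $H$-module is an $H$-module Lie algebra if $h[a,b]=[h_{(1)}a,h_{(2)}b]$ for all $h\in H$, $a,b\in L$. If $V$ is an $H$-module and $\psi\colon L\to\mathfrak{gl}(V)$ is a representation, $(V,\psi)$ is an $(H,L)$-module if $h(\psi(a)v)=\psi(h_{(1)}a)(h_{(2)}v)$ for all $a\in L$, $h\in H$, $v\in V$. An $(H,L)$-submodule is an $L$-submodule that is also an $H$-submodule; $(V,\psi)$ is irreducible if it has no nontrivial $L$-submodules that are $H$-submodules at the same time. Comodule version: a Lie algebra $L$ that is a right $H$-comodule is an $H$-comodule Lie algebra if $\rho([a,b])=[a_{(0)},b_{(0)}]\otimes a_{(1)}b_{(1)}$ for all $a,b\in L$. If $V$ is a right $H$-comodule with comodule map $\rho_V$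 and $\psi\colon L\to\mathfrak{gl}(V)$ is a representation, $(V,\psi)$ is an $(H,L)$-module if $\rho_V(\psi(a)v)=\psi(a_{(0)})v_{(0)}\otimes a_{(1)}v_{(1)}$ for all $a\in L$, $v\in V$. An $(H,L)$-submodule is an $L$-submodule that is also an $H$-subcomodule (a subspace $W$ with $\rho_V(W)\subseteq W\otimes H$); $(V,\psi)$ is irreducible if it has no nontrivial $L$-submodules that are $H$-subcomodules at the same time. *)

theory Defs
  imports Complex_Main "HOL-Library.FuncSet"
begin

section \<open>Vector spaces and tensor products\<close>

definition finite_dimensional :: "('f::field \<Rightarrow> 'a::ab_group_add \<Rightarrow> 'a) \<Rightarrow> bool" where
  "finite_dimensional scale \<longleftrightarrow> (\<exists>Basis. finite_dimensional_vector_space scale Basis)"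

definition bilinear_map ::
  "('f::field \<Rightarrow> 'a::ab_group_add \<Rightarrow> 'a) \<Rightarrow> ('f \<Rightarrow> 'b::ab_group_add \<Rightarrow> 'b) \<Rightarrow>
   ('f \<Rightarrow> 'c::ab_group_add \<Rightarrow> 'c) \<Rightarrow> ('a \<Rightarrow> 'b \<Rightarrow> 'c) \<Rightarrow> bool" where
  "bilinear_map sA sB sC \<beta> \<longleftrightarrow>
     (\<forall>b. Vector_Spaces.linear sA sC (\<lambda>a. \<beta> a b)) \<and>
     (\<forall>a. Vector_Spaces.linear sB sC (\<beta> a))"

text \<open>
  The scalar multiplications are parameters and not type class operations, so the tensor product
  over the ground field cannot be a type constructor. Instead, an element of the tensor product
  of A and B is written as a finite formal sum of elementary tensors, i.e. as a list of pairs,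
  the list \<open>[(a1,b1), ..., (an,bn)]\<close> standing for the sum of the ai \<open>\<otimes>\<close> bi. Appending lists is
  addition, and equality in the tensor product is the congruence generated by commutativity of
  addition and the bilinearity relations. A map into a tensor product is
  given by a choice of representing formal sums, and every equation between tensors
  is stated up to this congruence. The Sweedler sum of \<open>f\<close> over the comultiplication
  of \<open>h\<close>, for bilinear \<open>f\<close>, is \<open>\<Sum>(x, y)\<leftarrow>\<Delta> h. f x y\<close>; by the lemma
  \<open>tensor_eq_bilinear\<close> below it does not depend on the representative.
\<close>

inductive formal_sum_eq :: "('x list \<Rightarrow> 'x list \<Rightarrow> bool) \<Rightarrow> 'x list \<Rightarrow> 'x list \<Rightarrow> bool"
  for R where
  gen: "R u v \<Longrightarrow> formal_sum_eq R u v"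
| refl: "formal_sum_eq R u u"
| sym: "formal_sum_eq R u v \<Longrightarrow> formal_sum_eq R v u"
| trans: "formal_sum_eq R u v \<Longrightarrow> formal_sum_eq R v w \<Longrightarrow> formal_sum_eq R u w"
| add: "formal_sum_eq R u u' \<Longrightarrow> formal_sum_eq R v v' \<Longrightarrow> formal_sum_eq R (u @ v) (u' @ v')"
| comm: "formal_sum_eq R (u @ v) (v @ u)"

inductive bilinear_rel ::
  "('f::field \<Rightarrow> 'a::ab_group_add \<Rightarrow> 'a) \<Rightarrow> ('f \<Rightarrow> 'b::ab_group_add \<Rightarrow> 'b) \<Rightarrow>
   ('a \<times> 'b) list \<Rightarrow> ('a \<times> 'b) list \<Rightarrow> bool"
  for sA sB where
  "bilinear_rel sA sB [(a + a', b)] [(a, b), (a', b)]"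
| "bilinear_rel sA sB [(a, b + b')] [(a, b), (a, b')]"
| "bilinear_rel sA sB [(sA c a, b)] [(a, sB c b)]"
| "bilinear_rel sA sB [(0, b)] []"

inductive trilinear_rel ::
  "('f::field \<Rightarrow> 'a::ab_group_add \<Rightarrow> 'a) \<Rightarrow> ('f \<Rightarrow> 'b::ab_group_add \<Rightarrow> 'b) \<Rightarrow>
   ('f \<Rightarrow> 'c::ab_group_add \<Rightarrow> 'c) \<Rightarrow> ('a \<times> 'b \<times> 'c) list \<Rightarrow> ('a \<times> 'b \<times> 'c) list \<Rightarrow> bool"
  for sA sB sC where
  "trilinear_rel sA sB sC [(a + a', b, c)] [(a, b, c), (a', b, c)]"
| "trilinear_rel sA sB sC [(a, b + b', c)] [(a, b, c), (a, b', c)]"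
| "trilinear_rel sA sB sC [(a, b, c + c')] [(a, b, c), (a, b, c')]"
| "trilinear_rel sA sB sC [(sA k a, b, c)] [(a, sB k b, c)]"
| "trilinear_rel sA sB sC [(a, sB k b, c)] [(a, b, sC k c)]"
| "trilinear_rel sA sB sC [(0, b, c)] []"

abbreviation "tensor_eq sA sB \<equiv> formal_sum_eq (bilinear_rel sA sB)"
abbreviation "tensor3_eq sA sB sC \<equiv> formal_sum_eq (trilinear_rel sA sB sC)"

definition tensor_scale :: "('f \<Rightarrow> 'a \<Rightarrow> 'a) \<Rightarrow> 'f \<Rightarrow> ('a \<times> 'b) list \<Rightarrow> ('a \<times> 'b) list" where
  "tensor_scale sA c u = map (\<lambda>(a, b). (sA c a, b)) u"

definition linear_to_tensor ::
  "('f::field \<Rightarrow> 'x::ab_group_add \<Rightarrow> 'x) \<Rightarrow> ('f \<Rightarrow> 'a::ab_group_add \<Rightarrow> 'a) \<Rightarrow>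
   ('f \<Rightarrow> 'b::ab_group_add \<Rightarrow> 'b) \<Rightarrow> ('x \<Rightarrow> ('a \<times> 'b) list) \<Rightarrow> bool" where
  "linear_to_tensor sX sA sB f \<longleftrightarrow>
     (\<forall>x y. tensor_eq sA sB (f (x + y)) (f x @ f y)) \<and>
     (\<forall>c x. tensor_eq sA sB (f (sX c x)) (tensor_scale sA c (f x)))"

lemma formal_sum_eq_sum_list:
  fixes g :: "'x \<Rightarrow> 'c::comm_monoid_add"
  assumes "formal_sum_eq R u v"
    and "\<And>u v. R u v \<Longrightarrow> (\<Sum>x\<leftarrow>u. g x) = (\<Sum>x\<leftarrow>v. g x)"
  shows "(\<Sum>x\<leftarrow>u. g x) = (\<Sum>x\<leftarrow>v. g x)"
  using assms(1) by induction (simp_all add: assms(2) add.commute)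

lemma tensor_eq_bilinear:
  assumes "bilinear_map sA sB sC \<beta>" "tensor_eq sA sB u v"
  shows "(\<Sum>(a, b)\<leftarrow>u. \<beta> a b) = (\<Sum>(a, b)\<leftarrow>v. \<beta> a b)"
proof (rule formal_sum_eq_sum_list[OF assms(2)])
  interpret l: Vector_Spaces.linear sA sC "\<lambda>a. \<beta> a b" for b
    using assms(1) by (simp add: bilinear_map_def)
  interpret r: Vector_Spaces.linear sB sC "\<beta> a" for a
    using assms(1) by (simp add: bilinear_map_def)
  show "(\<Sum>(a, b)\<leftarrow>u. \<beta> a b) = (\<Sum>(a, b)\<leftarrow>v. \<beta> a b)" if "bilinear_rel sA sB u v" for u v
    using that by cases (simp_all add: l.add r.add l.scale r.scale l.zero)
qed

section \<open>Direct sums and complete reducibility\<close>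

definition direct_sum_decomposition :: "nat \<Rightarrow> (nat \<Rightarrow> 'v::ab_group_add set) \<Rightarrow> bool" where
  "direct_sum_decomposition s W \<longleftrightarrow>
     (\<forall>v. \<exists>!w. w \<in> (\<Pi>\<^sub>E i\<in>{1..s}. W i) \<and> v = (\<Sum>i=1..s. w i))"

text \<open>
  Here \<open>P\<close> is the predicate of being a subobject (submodule, subcoalgebra, ...) of the ambient
  object, which is the whole type \<open>'v\<close>. Subobjects of a subobject are the subobjects contained
  in it. The zero object is not irreducible, but is completely reducible (with \<open>s = 0\<close>).
\<close>

definition irreducible_sub :: "('v::ab_group_add set \<Rightarrow> bool) \<Rightarrow> 'v set \<Rightarrow> bool" where
  "irreducible_sub P W \<longleftrightarrow> P W \<and> W \<noteq> {0} \<and> (\<forall>U. P U \<and> U \<subseteq> W \<longrightarrow> U = {0} \<or> U = W)"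

definition completely_reducible :: "('v::ab_group_add set \<Rightarrow> bool) \<Rightarrow> bool" where
  "completely_reducible P \<longleftrightarrow>
     (\<exists>s W. (\<forall>i\<in>{1..s}. irreducible_sub P (W i)) \<and> direct_sum_decomposition s W)"

section \<open>Hopf algebras\<close>

locale unital_algebra = vector_space scale
  for scale :: "'f::field \<Rightarrow> 'h::ring_1 \<Rightarrow> 'h" +
  assumes scale_mult_left: "scale c x * y = scale c (x * y)"
    and scale_mult_right: "x * scale c y = scale c (x * y)"

locale coalgebra = vector_space scale
  for scale :: "'f::field \<Rightarrow> 'h::ab_group_add \<Rightarrow> 'h" +
  fixes \<Delta> :: "'h \<Rightarrow> ('h \<times> 'h) list"
    and \<epsilon> :: "'h \<Rightarrow> 'f"
  assumes comult_linear: "linear_to_tensor scale scale scale \<Delta>"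
    and counit_linear: "Vector_Spaces.linear scale (*) \<epsilon>"
    and coassoc: "tensor3_eq scale scale scale
          [(x1, x2, y). (x, y) \<leftarrow> \<Delta> h, (x1, x2) \<leftarrow> \<Delta> x]
          [(x, y1, y2). (x, y) \<leftarrow> \<Delta> h, (y1, y2) \<leftarrow> \<Delta> y]"
    and counit_left: "(\<Sum>(x, y)\<leftarrow>\<Delta> h. scale (\<epsilon> x) y) = h"
    and counit_right: "(\<Sum>(x, y)\<leftarrow>\<Delta> h. scale (\<epsilon> y) x) = h"

locale bialgebra = unital_algebra scale + coalgebra scale \<Delta> \<epsilon>
  for scale :: "'f::field \<Rightarrow> 'h::ring_1 \<Rightarrow> 'h"
    and \<Delta> :: "'h \<Rightarrow> ('h \<times> 'h) list"
    and \<epsilon> :: "'h \<Rightarrow> 'f" +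
  assumes comult_mult: "tensor_eq scale scale (\<Delta> (h * k))
          [(x * x', y * y'). (x, y) \<leftarrow> \<Delta> h, (x', y') \<leftarrow> \<Delta> k]"
    and comult_one: "tensor_eq scale scale (\<Delta> 1) [(1, 1)]"
    and counit_mult: "\<epsilon> (h * k) = \<epsilon> h * \<epsilon> k"
    and counit_one: "\<epsilon> 1 = 1"

locale hopf_algebra = bialgebra scale \<Delta> \<epsilon>
  for scale :: "'f::field \<Rightarrow> 'h::ring_1 \<Rightarrow> 'h"
    and \<Delta> :: "'h \<Rightarrow> ('h \<times> 'h) list"
    and \<epsilon> :: "'h \<Rightarrow> 'f" +
  fixes S :: "'h \<Rightarrow> 'h"
  assumes antipode_linear: "Vector_Spaces.linear scale scale S"
    and antipode_left: "(\<Sum>(x, y)\<leftarrow>\<Delta> h. S x * y) = scale (\<epsilon> h) 1"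
    and antipode_right: "(\<Sum>(x, y)\<leftarrow>\<Delta> h. x * S y) = scale (\<epsilon> h) 1"

text \<open>
  A finite dimensional algebra is semisimple if it is a direct sum of minimal left ideals (i.e. the
  left regular module is semisimple), and a finite dimensional coalgebra is cosemisimple if it is a
  direct sum of simple subcoalgebras. Finite dimension is why finite direct sums suffice.
\<close>

definition left_ideal :: "('f::field \<Rightarrow> 'h::ring_1 \<Rightarrow> 'h) \<Rightarrow> 'h set \<Rightarrow> bool" where
  "left_ideal scale I \<longleftrightarrow> module.subspace scale I \<and> (\<forall>h. \<forall>x\<in>I. h * x \<in> I)"

definition semisimple :: "('f::field \<Rightarrow> 'h::ring_1 \<Rightarrow> 'h) \<Rightarrow> bool" where
  "semisimple scale \<longleftrightarrow> completely_reducible (left_ideal scale)"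

definition subcoalgebra ::
  "('f::field \<Rightarrow> 'h::ab_group_add \<Rightarrow> 'h) \<Rightarrow> ('h \<Rightarrow> ('h \<times> 'h) list) \<Rightarrow> 'h set \<Rightarrow> bool" where
  "subcoalgebra scale \<Delta> C \<longleftrightarrow> module.subspace scale C \<and>
     (\<forall>c\<in>C. \<exists>u. set u \<subseteq> C \<times> C \<and> tensor_eq scale scale (\<Delta> c) u)"

definition cosemisimple ::
  "('f::field \<Rightarrow> 'h::ab_group_add \<Rightarrow> 'h) \<Rightarrow> ('h \<Rightarrow> ('h \<times> 'h) list) \<Rightarrow> bool" where
  "cosemisimple scale \<Delta> \<longleftrightarrow> completely_reducible (subcoalgebra scale \<Delta>)"

section \<open>Lie algebras and their representations\<close>

locale lie_algebra = vector_space scale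
  for scale :: "'f::field \<Rightarrow> 'l::ab_group_add \<Rightarrow> 'l" +
  fixes br :: "'l \<Rightarrow> 'l \<Rightarrow> 'l"
  assumes br_bilinear: "bilinear_map scale scale scale br"
    and br_alternating: "br a a = 0"
    and jacobi: "br a (br b c) + br b (br c a) + br c (br a b) = 0"

locale lie_representation = lie: lie_algebra scaleL br + V: vector_space scaleV
  for scaleL :: "'f::field \<Rightarrow> 'l::ab_group_add \<Rightarrow> 'l"
    and br :: "'l \<Rightarrow> 'l \<Rightarrow> 'l"
    and scaleV :: "'f \<Rightarrow> 'v::ab_group_add \<Rightarrow> 'v" +
  fixes \<psi> :: "'l \<Rightarrow> 'v \<Rightarrow> 'v"
  assumes rep_bilinear: "bilinear_map scaleL scaleV scaleV \<psi>"
    and rep_br: "\<psi> (br a b) v = \<psi> a (\<psi> b v) - \<psi> b (\<psi> a v)"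

definition L_submodule ::
  "('f::field \<Rightarrow> 'v::ab_group_add \<Rightarrow> 'v) \<Rightarrow> ('l \<Rightarrow> 'v \<Rightarrow> 'v) \<Rightarrow> 'v set \<Rightarrow> bool" where
  "L_submodule scaleV \<psi> W \<longleftrightarrow> module.subspace scaleV W \<and> (\<forall>a. \<forall>w\<in>W. \<psi> a w \<in> W)"

section \<open>Hopf module Lie algebras\<close>

locale algebra_module = unital_algebra scaleH + V: vector_space scaleV
  for scaleH :: "'f::field \<Rightarrow> 'h::ring_1 \<Rightarrow> 'h"
    and scaleV :: "'f \<Rightarrow> 'v::ab_group_add \<Rightarrow> 'v" +
  fixes act :: "'h \<Rightarrow> 'v \<Rightarrow> 'v"
  assumes act_bilinear: "bilinear_map scaleH scaleV scaleV act"
    and act_one: "act 1 v = v"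
    and act_mult: "act (h * k) v = act h (act k v)"

locale H_module_lie_algebra =
  hopf_algebra scaleH \<Delta> \<epsilon> S + lie: lie_algebra scaleL br + L: algebra_module scaleH scaleL actL
  for scaleH :: "'f::field \<Rightarrow> 'h::ring_1 \<Rightarrow> 'h"
    and \<Delta> :: "'h \<Rightarrow> ('h \<times> 'h) list"
    and \<epsilon> :: "'h \<Rightarrow> 'f"
    and S :: "'h \<Rightarrow> 'h"
    and scaleL :: "'f \<Rightarrow> 'l::ab_group_add \<Rightarrow> 'l"
    and br :: "'l \<Rightarrow> 'l \<Rightarrow> 'l"
    and actL :: "'h \<Rightarrow> 'l \<Rightarrow> 'l" +
  assumes act_br: "actL h (br a b) = (\<Sum>(x, y)\<leftarrow>\<Delta> h. br (actL x a) (actL y b))"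

locale module_HL_module =
  H_module_lie_algebra scaleH \<Delta> \<epsilon> S scaleL br actL +
  rep: lie_representation scaleL br scaleV \<psi> + V: algebra_module scaleH scaleV actV
  for scaleH :: "'f::field \<Rightarrow> 'h::ring_1 \<Rightarrow> 'h"
    and \<Delta> :: "'h \<Rightarrow> ('h \<times> 'h) list"
    and \<epsilon> :: "'h \<Rightarrow> 'f"
    and S :: "'h \<Rightarrow> 'h"
    and scaleL :: "'f \<Rightarrow> 'l::ab_group_add \<Rightarrow> 'l"
    and br :: "'l \<Rightarrow> 'l \<Rightarrow> 'l"
    and actL :: "'h \<Rightarrow> 'l \<Rightarrow> 'l"
    and scaleV :: "'f \<Rightarrow> 'v::ab_group_add \<Rightarrow> 'v"
    and \<psi> :: "'l \<Rightarrow> 'v \<Rightarrow> 'v"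
    and actV :: "'h \<Rightarrow> 'v \<Rightarrow> 'v" +
  assumes act_rep: "actV h (\<psi> a v) = (\<Sum>(x, y)\<leftarrow>\<Delta> h. \<psi> (actL x a) (actV y v))"

definition module_HL_submodule ::
  "('f::field \<Rightarrow> 'v::ab_group_add \<Rightarrow> 'v) \<Rightarrow> ('l \<Rightarrow> 'v \<Rightarrow> 'v) \<Rightarrow> ('h \<Rightarrow> 'v \<Rightarrow> 'v) \<Rightarrow>
   'v set \<Rightarrow> bool" where
  "module_HL_submodule scaleV \<psi> actV W \<longleftrightarrow>
     L_submodule scaleV \<psi> W \<and> (\<forall>h. \<forall>w\<in>W. actV h w \<in> W)"

section \<open>Hopf comodule Lie algebras\<close>

locale right_comodule = coalgebra scaleH \<Delta> \<epsilon> + V: vector_space scaleV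
  for scaleH :: "'f::field \<Rightarrow> 'h::ab_group_add \<Rightarrow> 'h"
    and \<Delta> :: "'h \<Rightarrow> ('h \<times> 'h) list"
    and \<epsilon> :: "'h \<Rightarrow> 'f"
    and scaleV :: "'f \<Rightarrow> 'v::ab_group_add \<Rightarrow> 'v" +
  fixes \<rho> :: "'v \<Rightarrow> ('v \<times> 'h) list"
  assumes coact_linear: "linear_to_tensor scaleV scaleV scaleH \<rho>"
    and coact_coassoc: "tensor3_eq scaleV scaleH scaleH
          [(w, x, y). (u, y) \<leftarrow> \<rho> v, (w, x) \<leftarrow> \<rho> u]
          [(u, x, y). (u, h) \<leftarrow> \<rho> v, (x, y) \<leftarrow> \<Delta> h]"
    and coact_counit: "(\<Sum>(u, h)\<leftarrow>\<rho> v. scaleV (\<epsilon> h) u) = v"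

locale H_comodule_lie_algebra =
  hopf_algebra scaleH \<Delta> \<epsilon> S + lie: lie_algebra scaleL br + L: right_comodule scaleH \<Delta> \<epsilon> scaleL \<rho>L
  for scaleH :: "'f::field \<Rightarrow> 'h::ring_1 \<Rightarrow> 'h"
    and \<Delta> :: "'h \<Rightarrow> ('h \<times> 'h) list"
    and \<epsilon> :: "'h \<Rightarrow> 'f"
    and S :: "'h \<Rightarrow> 'h"
    and scaleL :: "'f \<Rightarrow> 'l::ab_group_add \<Rightarrow> 'l"
    and br :: "'l \<Rightarrow> 'l \<Rightarrow> 'l"
    and \<rho>L :: "'l \<Rightarrow> ('l \<times> 'h) list" +
  assumes coact_br: "tensor_eq scaleL scaleH (\<rho>L (br a b))
          [(br a0 b0, a1 * b1). (a0, a1) \<leftarrow> \<rho>L a, (b0, b1) \<leftarrow> \<rho>L b]"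

locale comodule_HL_module =
  H_comodule_lie_algebra scaleH \<Delta> \<epsilon> S scaleL br \<rho>L +
  rep: lie_representation scaleL br scaleV \<psi> + V: right_comodule scaleH \<Delta> \<epsilon> scaleV \<rho>V
  for scaleH :: "'f::field \<Rightarrow> 'h::ring_1 \<Rightarrow> 'h"
    and \<Delta> :: "'h \<Rightarrow> ('h \<times> 'h) list"
    and \<epsilon> :: "'h \<Rightarrow> 'f"
    and S :: "'h \<Rightarrow> 'h"
    and scaleL :: "'f \<Rightarrow> 'l::ab_group_add \<Rightarrow> 'l"
    and br :: "'l \<Rightarrow> 'l \<Rightarrow> 'l"
    and \<rho>L :: "'l \<Rightarrow> ('l \<times> 'h) list"
    and scaleV :: "'f \<Rightarrow> 'v::ab_group_add \<Rightarrow> 'v"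
    and \<psi> :: "'l \<Rightarrow> 'v \<Rightarrow> 'v"
    and \<rho>V :: "'v \<Rightarrow> ('v \<times> 'h) list" +
  assumes coact_rep: "tensor_eq scaleV scaleH (\<rho>V (\<psi> a v))
          [(\<psi> a0 v0, a1 * v1). (a0, a1) \<leftarrow> \<rho>L a, (v0, v1) \<leftarrow> \<rho>V v]"

definition subcomodule ::
  "('f::field \<Rightarrow> 'h::ab_group_add \<Rightarrow> 'h) \<Rightarrow> ('f \<Rightarrow> 'v::ab_group_add \<Rightarrow> 'v) \<Rightarrow>
   ('v \<Rightarrow> ('v \<times> 'h) list) \<Rightarrow> 'v set \<Rightarrow> bool" where
  "subcomodule scaleH scaleV \<rho> W \<longleftrightarrow> module.subspace scaleV W \<and>
     (\<forall>w\<in>W. \<exists>u. set u \<subseteq> W \<times> UNIV \<and> tensor_eq scaleV scaleH (\<rho> w) u)"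

definition comodule_HL_submodule ::
  "('f::field \<Rightarrow> 'h::ab_group_add \<Rightarrow> 'h) \<Rightarrow> ('f \<Rightarrow> 'v::ab_group_add \<Rightarrow> 'v) \<Rightarrow>
   ('l \<Rightarrow> 'v \<Rightarrow> 'v) \<Rightarrow> ('v \<Rightarrow> ('v \<times> 'h) list) \<Rightarrow> 'v set \<Rightarrow> bool" where
  "comodule_HL_submodule scaleH scaleV \<psi> \<rho>V W \<longleftrightarrow>
     L_submodule scaleV \<psi> W \<and> subcomodule scaleH scaleV \<rho>V W"

end

theory Submission
  imports Defs
begin

text \<open>
  Both halves are instances of Maschke's argument. Let \<open>W\<close> be a subspace of \<open>V\<close> that is stable under
  \<open>L\<close> and under the action, respectively coaction, of \<open>H\<close>. Complete reducibility over \<open>L\<close> gives an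
  \<open>L\<close>-linear projection \<open>p\<close> of \<open>V\<close> onto \<open>W\<close>. Averaging \<open>p\<close> over \<open>H\<close> gives a projection onto \<open>W\<close> that is
  compatible with \<open>H\<close> as well, and its kernel is a complement of \<open>W\<close> of the same kind. As \<open>V\<close> has
  finite dimension, splitting off a minimal summand again and again ends in a direct sum of
  irreducible submodules.

  For modules, semisimplicity of \<open>H\<close> provides an element \<open>t\<close> with \<open>\<epsilon> t = 1\<close> and \<open>t h = \<epsilon>(h) t\<close>
  (\<open>semisimple_imp_integral\<close>), and the average of \<open>p\<close> is \<open>p'(v) = S(t\<^sub>1) p(t\<^sub>2 v)\<close>. It commutes with \<open>H\<close>
  because \<open>h\<^sub>1 S(x h\<^sub>2) = \<epsilon>(h) S(x)\<close> (\<open>comult_antipode_absorb_left\<close>). The delicate point is that it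
  commutes with \<open>L\<close>, because \<open>H\<close> moves the elements of \<open>L\<close> too. Carrying \<open>\<psi>(a)\<close> through \<open>t\<^sub>2\<close> and \<open>p\<close>
  leaves \<open>S(t\<^sub>1) \<psi>(t\<^sub>2 a) p(t\<^sub>3 v)\<close>, and the identity \<open>S(h\<^sub>1) \<psi>(h\<^sub>2 a) = \<psi>(a) S(h)\<close> of operators on \<open>V\<close>
  (\<open>antipode_rep_commute\<close>) undoes the twist. This is why the antipode stands on the outer factor:
  for \<open>t\<^sub>1 p(S(t\<^sub>2) v)\<close> the same computation ends in \<open>\<psi>(t\<^sub>1 S(t\<^sub>4) a)\<close>, where the two factors are not
  adjacent and need not cancel.

  For comodules everything is dualised. Cosemisimplicity of \<open>H\<close> provides a functional \<open>l\<close> with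
  \<open>l 1 = 1\<close> and \<open>l(h\<^sub>1) h\<^sub>2 = l(h) 1\<close> (\<open>cosemisimple_imp_cointegral\<close>), and the average of \<open>p\<close> is
  \<open>p'(v) = l(S(p(v\<^sub>0)\<^sub>1) v\<^sub>1) p(v\<^sub>0)\<^sub>0\<close>. It commutes with \<open>L\<close> because \<open>S(h\<^sub>1 x) h\<^sub>2 = \<epsilon>(h) S(x)\<close>
  (\<open>comult_antipode_absorb_right\<close>), and with the coaction because
  \<open>l(S(x\<^sub>2) y) x\<^sub>1 = l(S(x) y\<^sub>1) y\<^sub>2\<close> (\<open>cointegral_antipode\<close>).

  To treat both cases alike, the two kinds of submodule are described as the subspaces invariant under
  a set of linear operators. For a comodule these include the operators \<open>v \<mapsto> f(v\<^sub>1) v\<^sub>0\<close> for all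
  functionals \<open>f\<close> on \<open>H\<close>.
\<close>

section \<open>Invariant subspaces and complete reducibility\<close>

definition invariant_subspace ::
  "('f::field \<Rightarrow> 'v::ab_group_add \<Rightarrow> 'v) \<Rightarrow> ('v \<Rightarrow> 'v) set \<Rightarrow> 'v set \<Rightarrow> bool" where
  "invariant_subspace scale T W \<longleftrightarrow> module.subspace scale W \<and> (\<forall>t\<in>T. \<forall>w\<in>W. t w \<in> W)"

definition commuting_projection ::
  "('f::field \<Rightarrow> 'v::ab_group_add \<Rightarrow> 'v) \<Rightarrow> ('v \<Rightarrow> 'v) set \<Rightarrow> 'v set \<Rightarrow> ('v \<Rightarrow> 'v) \<Rightarrow> bool" where
  "commuting_projection scale T W p \<longleftrightarrow> Vector_Spaces.linear scale scale p \<and>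
     (\<forall>v. p v \<in> W) \<and> (\<forall>w\<in>W. p w = w) \<and> (\<forall>t\<in>T. \<forall>v. p (t v) = t (p v))"

text \<open>
  Existence and uniqueness of decompositions, split into two parts. Unlike
  \<open>direct_sum_decomposition\<close> this makes sense for a subspace \<open>W\<close>, so that it can be established
  by induction on the dimension of \<open>W\<close>, and uniqueness only has to be checked at \<open>0\<close>.
\<close>

definition spans_directly :: "nat \<Rightarrow> (nat \<Rightarrow> 'v::ab_group_add set) \<Rightarrow> 'v set \<Rightarrow> bool" where
  "spans_directly s X W \<longleftrightarrow>
     (\<forall>w\<in>W. \<exists>x\<in>Pi {1..s} X. w = (\<Sum>i=1..s. x i)) \<and>
     (\<forall>x\<in>Pi {1..s} X. (\<Sum>i=1..s. x i) = 0 \<longrightarrow> (\<forall>i\<in>{1..s}. x i = 0))"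

lemma (in finite_dimensional_vector_space) maximal_dim_subspace:
  assumes "P U0" "\<And>U. P U \<Longrightarrow> subspace U"
  obtains U where "P U" "\<And>U'. P U' \<Longrightarrow> U \<subseteq> U' \<Longrightarrow> U' = U"
proof -
  obtain U where U: "P U" "\<forall>U'. P U' \<longrightarrow> dim U' \<le> dim U"
    using ex_has_greatest_nat[of P U0 dim "Suc dimension", OF assms(1)] dim_subset_UNIV
    by (auto simp: less_Suc_eq_le)
  show ?thesis
  proof
    show "U' = U" if "P U'" "U \<subseteq> U'" for U'
      using subspace_dim_equal[of U U'] that U assms(2) by auto
  qed (fact U)
qed

lemma (in vector_space) direct_sum_decompositionI:
  assumes sub: "\<And>i. i \<in> {1..s} \<Longrightarrow> subspace (X i)" and dir: "spans_directly s X UNIV"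
  shows "direct_sum_decomposition s X"
  unfolding direct_sum_decomposition_def
proof
  fix v
  obtain x where x: "x \<in> Pi {1..s} X" "v = (\<Sum>i=1..s. x i)"
    using dir unfolding spans_directly_def by blast
  show "\<exists>!w. w \<in> Pi\<^sub>E {1..s} X \<and> v = (\<Sum>i=1..s. w i)"
  proof
    show "restrict x {1..s} \<in> Pi\<^sub>E {1..s} X \<and> v = (\<Sum>i=1..s. restrict x {1..s} i)"
      using x by auto
    fix w assume w: "w \<in> Pi\<^sub>E {1..s} X \<and> v = (\<Sum>i=1..s. w i)"
    have "(\<lambda>i. w i - x i) \<in> Pi {1..s} X"
      using w x(1) subspace_diff[OF sub] by (blast intro: Pi_I dest: Pi_mem PiE_mem)
    moreover have "(\<Sum>i=1..s. w i - x i) = 0" using w x by (simp add: sum_subtractf)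
    ultimately have "\<forall>i\<in>{1..s}. w i - x i = 0"
      using dir unfolding spans_directly_def by blast
    then show "w = restrict x {1..s}"
      using w by (intro ext) (auto simp: PiE_iff extensional_def)
  qed
qed

locale operator_space = finite_dimensional_vector_space scale Basis
  for scale :: "'f::field \<Rightarrow> 'v::ab_group_add \<Rightarrow> 'v" and Basis :: "'v set" +
  fixes T :: "('v \<Rightarrow> 'v) set"
  assumes linear_operator: "t \<in> T \<Longrightarrow> Vector_Spaces.linear scale scale t"
begin

abbreviation "invariant \<equiv> invariant_subspace scale T"

lemma invariant_subspaceD: "invariant W \<Longrightarrow> subspace W"
  by (simp add: invariant_subspace_def)

lemma operator_add: "t \<in> T \<Longrightarrow> t (x + y) = t x + t y"
  using linear_operator by (simp add: Vector_Spaces.linear_iff)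

lemma operator_zero: "t \<in> T \<Longrightarrow> t 0 = 0"
  using operator_add[of t 0 0] by simp

lemma invariant_Int: "invariant U \<Longrightarrow> invariant W \<Longrightarrow> invariant (U \<inter> W)"
  by (simp add: invariant_subspace_def subspace_inter)

lemma invariant_zero: "invariant {0}"
  by (simp add: invariant_subspace_def operator_zero)

lemma invariant_sums:
  assumes "invariant U" "invariant W"
  shows "invariant {u + w |u w. u \<in> U \<and> w \<in> W}"
  unfolding invariant_subspace_def
proof (intro conjI ballI)
  show "subspace {u + w |u w. u \<in> U \<and> w \<in> W}"
    using assms by (intro subspace_sums) (auto intro: invariant_subspaceD)
  fix t v assume t: "t \<in> T" and "v \<in> {u + w |u w. u \<in> U \<and> w \<in> W}"
  then obtain u w where uw: "u \<in> U" "w \<in> W" "v = u + w" by blast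
  then have "t u \<in> U" "t w \<in> W" using assms t by (auto simp: invariant_subspace_def)
  moreover have "t v = t u + t w" using uw operator_add[OF t] by simp
  ultimately show "t v \<in> {u + w |u w. u \<in> U \<and> w \<in> W}" by blast
qed

text \<open>
  Take \<open>U\<close> maximal among the invariant subspaces that meet \<open>W\<close> trivially. An irreducible summand
  not contained in \<open>W + U\<close> would meet it trivially and could be added to \<open>U\<close>.
\<close>

lemma completely_reducible_imp_complement:
  assumes "completely_reducible invariant" and W: "invariant W"
  obtains U where "invariant U" "W \<inter> U = {0}" "\<And>v. \<exists>w\<in>W. \<exists>u\<in>U. v = w + u"
proof -
  obtain s X where irr: "\<And>i. i \<in> {1..s} \<Longrightarrow> irreducible_sub invariant (X i)"
    and dsd: "direct_sum_decomposition s X"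
    using assms(1) unfolding completely_reducible_def by blast
  have sW: "subspace W" using W by (rule invariant_subspaceD)
  obtain U where U: "invariant U" "W \<inter> U = {0}"
    and max: "\<And>U'. invariant U' \<and> W \<inter> U' = {0} \<Longrightarrow> U \<subseteq> U' \<Longrightarrow> U' = U"
    using maximal_dim_subspace[of "\<lambda>U. invariant U \<and> W \<inter> U = {0}" "{0}"]
      invariant_zero invariant_subspaceD subspace_0[OF sW]
    by (metis Int_insert_right_if1 Int_empty_right)
  have sU: "subspace U" using U by (simp add: invariant_subspaceD)
  define WU where "WU = {w + u |w u. w \<in> W \<and> u \<in> U}"
  have iWU: "invariant WU" unfolding WU_def by (rule invariant_sums[OF W U(1)])
  have sWU: "subspace WU" using iWU by (rule invariant_subspaceD)
  have WWU: "W \<subseteq> WU" and UWU: "U \<subseteq> WU"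
    using subspace_0[OF sW] subspace_0[OF sU] unfolding WU_def by force+
  have Xi: "X i \<subseteq> WU" if i: "i \<in> {1..s}" for i
  proof (rule ccontr)
    assume "\<not> X i \<subseteq> WU"
    have iX: "invariant (X i)" using irr[OF i] by (simp add: irreducible_sub_def)
    have sX: "subspace (X i)" using iX by (rule invariant_subspaceD)
    have "X i \<inter> WU = {0}"
      using irr[OF i] invariant_Int[OF iX iWU] \<open>\<not> X i \<subseteq> WU\<close>
      unfolding irreducible_sub_def by blast
    define U' where "U' = {u + x |u x. u \<in> U \<and> x \<in> X i}"
    have "U \<subseteq> U'" "X i \<subseteq> U'"
      using subspace_0[OF sX] subspace_0[OF sU] unfolding U'_def by force+
    have "invariant U'" unfolding U'_def by (rule invariant_sums[OF U(1) iX])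
    moreover have "W \<inter> U' = {0}"
    proof -
      have "v = 0" if "v \<in> W" "v \<in> U'" for v
      proof -
        obtain u x where ux: "u \<in> U" "x \<in> X i" "v = u + x" using \<open>v \<in> U'\<close> U'_def by auto
        have "v - u \<in> WU" using that ux WWU UWU subspace_diff[OF sWU] by blast
        then have "x \<in> X i \<inter> WU" using ux by simp
        then have "x = 0" using \<open>X i \<inter> WU = {0}\<close> by blast
        then have "v \<in> W \<inter> U" using ux that by simp
        then show "v = 0" using U by blast
      qed
      moreover have "0 \<in> W" "0 \<in> U'" using subspace_0 sW \<open>U \<subseteq> U'\<close> sU by auto
      ultimately show ?thesis by blast
    qed
    ultimately have "U' = U" using max \<open>U \<subseteq> U'\<close> by blast
    then show False using \<open>X i \<subseteq> U'\<close> UWU \<open>\<not> X i \<subseteq> WU\<close> by blast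
  qed
  have "v \<in> WU" for v
  proof -
    obtain w where w: "w \<in> (\<Pi>\<^sub>E i\<in>{1..s}. X i)" "v = (\<Sum>i=1..s. w i)"
      using dsd unfolding direct_sum_decomposition_def by blast
    have "w i \<in> WU" if "i \<in> {1..s}" for i using PiE_mem[OF w(1) that] Xi[OF that] by blast
    then show ?thesis unfolding w(2) by (rule subspace_sum[OF sWU])
  qed
  then have "\<exists>w\<in>W. \<exists>u\<in>U. v = w + u" for v unfolding WU_def by blast
  then show ?thesis using that U by blast
qed

lemma completely_reducible_imp_projection:
  assumes "completely_reducible invariant" and W: "invariant W"
  obtains p where "commuting_projection scale T W p"
proof -
  obtain U where U: "invariant U" "W \<inter> U = {0}" "\<And>v. \<exists>w\<in>W. \<exists>u\<in>U. v = w + u"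
    using completely_reducible_imp_complement[OF assms] by blast
  have sW: "subspace W" and sU: "subspace U" using W U by (auto intro: invariant_subspaceD)
  obtain p where p: "\<And>v. p v \<in> W" "\<And>v. v - p v \<in> U"
    using U(3) by (metis add_diff_cancel_left')
  have p_eq: "p v = w" if "w \<in> W" "v - w \<in> U" for v w
  proof -
    have "p v - w \<in> W" using p that sW subspace_diff by blast
    moreover have "(v - w) - (v - p v) \<in> U" using p that sU subspace_diff by blast
    ultimately have "p v - w \<in> W \<inter> U" by simp
    then show ?thesis using U(2) by simp
  qed
  have "Vector_Spaces.linear scale scale p"
    unfolding Vector_Spaces.linear_iff
  proof (intro conjI allI vector_space_axioms)
    fix x y c
    have "(x - p x) + (y - p y) \<in> U" using p sU subspace_add by blast
    then show "p (x + y) = p x + p y"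
      using p_eq[of "p x + p y" "x + y"] p sW subspace_add by (simp add: algebra_simps)
    have "scale c (x - p x) \<in> U" using p sU subspace_scale by blast
    then show "p (scale c x) = scale c (p x)"
      using p_eq[of "scale c (p x)" "scale c x"] p sW subspace_scale
      by (simp add: scale_right_diff_distrib)
  qed
  moreover have "p w = w" if "w \<in> W" for w
    using p_eq[OF that] subspace_0[OF sU] by simp
  moreover have "p (t v) = t (p v)" if t: "t \<in> T" for t v
  proof (rule p_eq)
    show "t (p v) \<in> W" using p t W by (simp add: invariant_subspace_def)
    have "t (v - p v) \<in> U" using p t U by (simp add: invariant_subspace_def)
    then show "t v - t (p v) \<in> U"
      using operator_add[OF t, of "v - p v" "p v"] by simp
  qed
  ultimately have "commuting_projection scale T W p"
    using p(1) by (simp add: commuting_projection_def)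
  then show ?thesis by (rule that)
qed

lemma projection_imp_complement:
  assumes "commuting_projection scale T W p"
  shows "invariant {v. p v = 0}" "W \<inter> {v. p v = 0} \<subseteq> {0}" "\<And>v. v - p v \<in> {v. p v = 0}"
proof -
  interpret p: Vector_Spaces.linear scale scale p
    using assms by (simp add: commuting_projection_def)
  show "invariant {v. p v = 0}"
    using assms operator_zero p.subspace_kernel
    by (auto simp: invariant_subspace_def commuting_projection_def)
  show "W \<inter> {v. p v = 0} \<subseteq> {0}" "\<And>v. v - p v \<in> {v. p v = 0}"
    using assms by (auto simp: commuting_projection_def p.diff)
qed

lemma irreducible_summand_exists:
  assumes W: "invariant W" "W \<noteq> {0}"
  obtains U where "irreducible_sub invariant U" "U \<subseteq> W"
proof -
  let ?P = "\<lambda>U. invariant U \<and> U \<noteq> {0} \<and> U \<subseteq> W"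
  obtain U where U: "?P U" "\<And>U'. ?P U' \<Longrightarrow> dim U \<le> dim U'"
    using ex_has_least_nat[of ?P W dim] W by auto
  have "irreducible_sub invariant U"
    unfolding irreducible_sub_def
  proof (intro conjI allI impI)
    fix U' assume U': "invariant U' \<and> U' \<subseteq> U"
    show "U' = {0} \<or> U' = U"
    proof (cases "U' = {0}")
      case False
      then have "dim U \<le> dim U'" using U U' by blast
      then show ?thesis using subspace_dim_equal[of U' U] U U' invariant_subspaceD by blast
    qed simp
  qed (use U in auto)
  then show ?thesis using that U by blast
qed

text \<open>
  A minimal nonzero invariant \<open>U \<subseteq> W\<close> is irreducible, and a projection of the whole space onto \<open>U\<close>
  restricts to \<open>W\<close>: the part of its kernel inside \<open>W\<close> is an invariant complement of \<open>U\<close> in \<open>W\<close>, of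
  smaller dimension.
\<close>

lemma decomposition_of_invariant_subspace:
  assumes proj: "\<forall>W. invariant W \<longrightarrow> (\<exists>p. commuting_projection scale T W p)"
    and "invariant W"
  shows "\<exists>s X. (\<forall>i\<in>{1..s}. irreducible_sub invariant (X i) \<and> X i \<subseteq> W) \<and> spans_directly s X W"
  using assms(2)
proof (induction "dim W" arbitrary: W rule: less_induct)
  case less
  show ?case
  proof (cases "W = {0}")
    case True
    then show ?thesis by (intro exI[of _ "0::nat"]) (auto simp: spans_directly_def intro!: exI)
  next
    case False
    obtain U where U: "irreducible_sub invariant U" "U \<subseteq> W"
      using irreducible_summand_exists[OF less.prems False] .
    have iU: "invariant U" and sU: "subspace U" and "U \<noteq> {0}"
      using U by (auto simp: irreducible_sub_def invariant_subspace_def)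
    obtain p where p: "commuting_projection scale T U p" using proj iU by blast
    interpret p: Vector_Spaces.linear scale scale p
      using p by (simp add: commuting_projection_def)
    have pU: "p v \<in> U" "u \<in> U \<Longrightarrow> p u = u" for u v
      using p by (auto simp: commuting_projection_def)
    define Y where "Y = {v. p v = 0} \<inter> W"
    have iY: "invariant Y"
      unfolding Y_def by (rule invariant_Int[OF projection_imp_complement(1)[OF p] less.prems])
    have sW: "subspace W" and sY: "subspace Y"
      using less.prems iY by (auto intro: invariant_subspaceD)
    have "Y \<noteq> W"
    proof
      assume "Y = W"
      have "u = 0" if "u \<in> U" for u
        using pU(2)[OF that] U(2) \<open>Y = W\<close> that unfolding Y_def by force
      then have "U \<subseteq> {0}" by blast
      then show False using \<open>U \<noteq> {0}\<close> subspace_0[OF sU] by blast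
    qed
    moreover have "Y \<subseteq> W" by (simp add: Y_def)
    ultimately have "dim Y < dim W"
      using subspace_dim_equal[OF sY sW] by force
    then obtain s X where X: "\<And>i. i\<in>{1..s} \<Longrightarrow> irreducible_sub invariant (X i) \<and> X i \<subseteq> Y"
      and dir: "spans_directly s X Y"
      using less.hyps[OF _ iY] by blast
    have span: "\<And>w. w\<in>Y \<Longrightarrow> \<exists>x\<in>Pi {1..s} X. w = (\<Sum>i=1..s. x i)"
      and ind: "\<And>x. x\<in>Pi {1..s} X \<Longrightarrow> (\<Sum>i=1..s. x i) = 0 \<Longrightarrow> \<forall>i\<in>{1..s}. x i = 0"
      using dir unfolding spans_directly_def by blast+
    define Z where "Z = X(Suc s := U)"
    have ZX: "Z i = X i" if "i \<in> {1..s}" for i using that by (auto simp: Z_def)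
    have ZU: "Z (Suc s) = U" by (simp add: Z_def)
    show ?thesis
      unfolding spans_directly_def
    proof (intro exI[of _ "Suc s"] exI[of _ Z] conjI ballI impI)
      fix i assume i: "i \<in> {1..Suc s}"
      show "irreducible_sub invariant (Z i)" "Z i \<subseteq> W"
        using X[of i] ZX[of i] ZU U \<open>Y \<subseteq> W\<close> i by (cases "i = Suc s"; force)+
    next
      fix w assume w: "w \<in> W"
      have "w - p w \<in> Y"
        using projection_imp_complement(3)[OF p, of w] subspace_diff[OF sW w] pU U(2)
        by (auto simp: Y_def)
      then obtain x where x: "x \<in> Pi {1..s} X" "w - p w = (\<Sum>i=1..s. x i)" using span by blast
      have "w = (\<Sum>i=1..Suc s. (x(Suc s := p w)) i)"
        using x(2) by (simp add: algebra_simps)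
      moreover have "x(Suc s := p w) \<in> Pi {1..Suc s} Z"
        using x(1) pU by (auto simp: Z_def Pi_iff)
      ultimately show "\<exists>x\<in>Pi {1..Suc s} Z. w = (\<Sum>i=1..Suc s. x i)" by blast
    next
      fix x i assume x: "x \<in> Pi {1..Suc s} Z" "(\<Sum>i=1..Suc s. x i) = 0" and i: "i \<in> {1..Suc s}"
      have xX: "x \<in> Pi {1..s} X" using x(1) ZX by (force simp: Pi_iff)
      have xU: "x (Suc s) \<in> U" using x(1) ZU by (force simp: Pi_iff)
      have "(\<Sum>i=1..s. x i) \<in> Y"
        using Pi_mem[OF xX] X by (blast intro: subspace_sum[OF sY])
      moreover have "x (Suc s) + (\<Sum>i=1..s. x i) = 0" using x(2) by (simp add: add.commute)
      ultimately have "p (x (Suc s)) = 0"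
        using p.add[of "x (Suc s)" "\<Sum>i=1..s. x i"] p.zero by (simp add: Y_def)
      then have "x (Suc s) = 0" using pU(2)[OF xU] by simp
      then show "x i = 0" using ind[OF xX] x(2) i by (cases "i = Suc s") auto
    qed
  qed
qed

lemma projections_imp_completely_reducible:
  assumes "\<And>W. invariant W \<Longrightarrow> \<exists>p. commuting_projection scale T W p"
  shows "completely_reducible invariant"
proof -
  have "\<forall>W. invariant W \<longrightarrow> (\<exists>p. commuting_projection scale T W p)" using assms by blast
  moreover have "invariant UNIV" by (simp add: invariant_subspace_def)
  ultimately obtain s X
    where X: "\<forall>i\<in>{1..s}. irreducible_sub invariant (X i)" "spans_directly s X UNIV"
    using decomposition_of_invariant_subspace by meson
  have "direct_sum_decomposition s X"
    using X by (intro direct_sum_decompositionI) (auto simp: irreducible_sub_def invariant_subspace_def)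
  then show ?thesis using X unfolding completely_reducible_def by blast
qed

end

lemma direct_sum_projections:
  fixes scale :: "'f::field \<Rightarrow> 'v::ab_group_add \<Rightarrow> 'v"
  assumes "vector_space scale" and dsd: "direct_sum_decomposition s X"
    and sub: "\<And>i. i \<in> {1..s} \<Longrightarrow> module.subspace scale (X i)"
  obtains \<pi> where "\<And>i. i \<in> {1..s} \<Longrightarrow> Vector_Spaces.linear scale scale (\<pi> i)"
    "\<And>i v. i \<in> {1..s} \<Longrightarrow> \<pi> i v \<in> X i"
    "\<And>v. v = (\<Sum>i=1..s. \<pi> i v)"
    "\<And>i j v. i \<in> {1..s} \<Longrightarrow> j \<in> {1..s} \<Longrightarrow> v \<in> X j \<Longrightarrow> \<pi> i v = (if i = j then v else 0)"
proof -
  interpret vector_space scale by fact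
  have uniq: "\<forall>v. \<exists>!w. w \<in> Pi\<^sub>E {1..s} X \<and> v = (\<Sum>i=1..s. w i)"
    using dsd by (simp add: direct_sum_decomposition_def)
  then obtain w where w: "\<And>v. w v \<in> Pi\<^sub>E {1..s} X" "\<And>v. v = (\<Sum>i=1..s. w v i)"
    by metis
  define \<pi> where "\<pi> i v = w v i" for i v
  have \<pi>_eq: "\<pi> i v = x i"
    if "\<And>j. j \<in> {1..s} \<Longrightarrow> x j \<in> X j" "v = (\<Sum>i=1..s. x i)" "i \<in> {1..s}" for x i v
  proof -
    have "restrict x {1..s} \<in> Pi\<^sub>E {1..s} X \<and> v = (\<Sum>i=1..s. restrict x {1..s} i)"
      using that by auto
    then have "w v = restrict x {1..s}" using w uniq by blast
    then show ?thesis using that by (simp add: \<pi>_def)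
  qed
  have in_X: "\<pi> i v \<in> X i" if "i \<in> {1..s}" for i v
    using w(1)[of v] that by (auto simp: \<pi>_def PiE_iff)
  have sum: "v = (\<Sum>i=1..s. \<pi> i v)" for v using w(2)[of v] by (simp add: \<pi>_def)
  show ?thesis
  proof (rule that[of \<pi>, OF _ in_X sum])
    fix i j v assume i: "i \<in> {1..s}"
    have "\<pi> i (x + y) = \<pi> i x + \<pi> i y" for x y
      by (rule \<pi>_eq[where x = "\<lambda>i. \<pi> i x + \<pi> i y"])
         (use i in_X sub sum[of x] sum[of y] in \<open>auto simp: sum.distrib subspace_add\<close>)
    moreover have "\<pi> i (scale c x) = scale c (\<pi> i x)" for c x
      by (rule \<pi>_eq[where x = "\<lambda>i. scale c (\<pi> i x)"])
         (use i in_X sub sum[of x] in \<open>auto simp: scale_sum_right[symmetric] subspace_scale\<close>)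
    ultimately show "Vector_Spaces.linear scale scale (\<pi> i)"
      by (simp add: Vector_Spaces.linear_iff vector_space_axioms)
    assume "j \<in> {1..s}" "v \<in> X j"
    then show "\<pi> i v = (if i = j then v else 0)"
      by (intro \<pi>_eq[where x = "\<lambda>i. if i = j then v else 0"])
         (use i sub in \<open>auto simp: subspace_0\<close>)
  qed
qed

section \<open>Sums over formal tensors\<close>

definition tensor_sum :: "('a \<times> 'b) list \<Rightarrow> ('a \<Rightarrow> 'b \<Rightarrow> 'c::comm_monoid_add) \<Rightarrow> 'c" where
  "tensor_sum u \<beta> = (\<Sum>(x, y)\<leftarrow>u. \<beta> x y)"

text \<open>
  The minimal condition under which \<open>tensor_sum u \<beta>\<close> depends only on the tensor that \<open>u\<close> represents.
  It mentions no scalar multiplication on the values of \<open>\<beta>\<close>, so that the simplifier can check it for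
  nested sums by moving scalars within the arguments.
\<close>

definition balanced ::
  "('f \<Rightarrow> 'a::ab_group_add \<Rightarrow> 'a) \<Rightarrow> ('f \<Rightarrow> 'b::ab_group_add \<Rightarrow> 'b) \<Rightarrow>
   ('a \<Rightarrow> 'b \<Rightarrow> 'c::ab_group_add) \<Rightarrow> bool" where
  "balanced sA sB \<beta> \<longleftrightarrow>
     (\<forall>a a' b. \<beta> (a + a') b = \<beta> a b + \<beta> a' b) \<and>
     (\<forall>a b b'. \<beta> a (b + b') = \<beta> a b + \<beta> a b') \<and>
     (\<forall>c a b. \<beta> a (sB c b) = \<beta> (sA c a) b)"

definition balanced3 ::
  "('f \<Rightarrow> 'a::ab_group_add \<Rightarrow> 'a) \<Rightarrow> ('f \<Rightarrow> 'b::ab_group_add \<Rightarrow> 'b) \<Rightarrow>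
   ('f \<Rightarrow> 'c::ab_group_add \<Rightarrow> 'c) \<Rightarrow> ('a \<Rightarrow> 'b \<Rightarrow> 'c \<Rightarrow> 'd::ab_group_add) \<Rightarrow> bool" where
  "balanced3 sA sB sC \<tau> \<longleftrightarrow> (\<forall>z. balanced sA sB (\<lambda>x y. \<tau> x y z)) \<and> (\<forall>x. balanced sB sC (\<tau> x))"

lemma tensor_sum_append: "tensor_sum (u @ v) \<beta> = tensor_sum u \<beta> + tensor_sum v \<beta>"
  by (simp add: tensor_sum_def)

lemma tensor_sum_add:
  "tensor_sum u (\<lambda>x y. \<beta> x y + \<gamma> x y) = tensor_sum u \<beta> + tensor_sum u \<gamma>"
  by (induction u) (auto simp: tensor_sum_def algebra_simps)

lemma tensor_sum_zero: "tensor_sum u (\<lambda>x y. 0) = 0"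
  by (induction u) (auto simp: tensor_sum_def)

lemma tensor_sum_additive:
  fixes F :: "'a::ab_group_add \<Rightarrow> 'b::ab_group_add"
  assumes "\<And>x y. F (x + y) = F x + F y"
  shows "F (tensor_sum u \<beta>) = tensor_sum u (\<lambda>x y. F (\<beta> x y))"
proof -
  have "F 0 = 0" using assms[of 0 0] by simp
  then show ?thesis by (induction u) (auto simp: tensor_sum_def assms)
qed

lemma tensor_sum_mult_left: "tensor_sum u (\<lambda>x y. a * \<beta> x y) = a * tensor_sum u \<beta>"
  for a :: "'a::ring"
  by (rule tensor_sum_additive[symmetric]) (rule distrib_left)

lemma tensor_sum_mult_right: "tensor_sum u (\<lambda>x y. \<beta> x y * a) = tensor_sum u \<beta> * a"
  for a :: "'a::ring"
  by (rule tensor_sum_additive[symmetric]) (rule distrib_right)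

lemma tensor_sum_swap:
  "tensor_sum u (\<lambda>x y. tensor_sum v (\<lambda>a b. f x y a b)) =
   tensor_sum v (\<lambda>a b. tensor_sum u (\<lambda>x y. f x y a b))"
proof (induction u)
  case (Cons p u)
  then show ?case by (cases p) (simp add: tensor_sum_def tensor_sum_add[unfolded tensor_sum_def])
qed (simp add: tensor_sum_def tensor_sum_zero[unfolded tensor_sum_def])

lemma tensor_sum_cong:
  assumes "\<And>x y. (x, y) \<in> set u \<Longrightarrow> \<beta> x y = \<gamma> x y"
  shows "tensor_sum u \<beta> = tensor_sum u \<gamma>"
  unfolding tensor_sum_def using assms by (auto intro!: arg_cong[of _ _ sum_list] map_cong)

lemma tensor_sum_concat:
  "(\<Sum>p\<leftarrow>concat (map (\<lambda>(x, y). F x y) u). g p) = tensor_sum u (\<lambda>x y. \<Sum>p\<leftarrow>F x y. g p)"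
  by (induction u) (auto simp: tensor_sum_def)

lemma tensor_sum_concat_tensor:
  "tensor_sum (concat (map (\<lambda>(x, y). F x y) u)) \<beta> = tensor_sum u (\<lambda>x y. tensor_sum (F x y) \<beta>)"
  unfolding tensor_sum_def[of "concat _"] tensor_sum_concat by (simp add: tensor_sum_def)

lemma tensor_sum_map:
  "tensor_sum (map (\<lambda>(x, y). (f x y, g x y)) u) \<beta> = tensor_sum u (\<lambda>x y. \<beta> (f x y) (g x y))"
  by (induction u) (auto simp: tensor_sum_def)

lemma tensor_sum_tensor_scale:
  "tensor_sum (tensor_scale sA c u) \<beta> = tensor_sum u (\<lambda>x y. \<beta> (sA c x) y)"
  by (induction u) (auto simp: tensor_sum_def tensor_scale_def)

lemma tensor_sum_eq:
  assumes "balanced sA sB \<beta>" "tensor_eq sA sB u v"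
  shows "tensor_sum u \<beta> = tensor_sum v \<beta>"
  unfolding tensor_sum_def
proof (rule formal_sum_eq_sum_list[OF assms(2)])
  have zero: "\<beta> 0 b = 0" for b
    using assms(1)[unfolded balanced_def, THEN conjunct1, rule_format, of 0 0 b] by simp
  show "(\<Sum>(a, b)\<leftarrow>u. \<beta> a b) = (\<Sum>(a, b)\<leftarrow>v. \<beta> a b)" if "bilinear_rel sA sB u v" for u v
    using that by cases (use assms(1) in \<open>auto simp: balanced_def zero\<close>)
qed

lemma tensor3_sum_eq:
  assumes "balanced3 sA sB sC \<tau>" "tensor3_eq sA sB sC u v"
  shows "(\<Sum>(x, y, z)\<leftarrow>u. \<tau> x y z) = (\<Sum>(x, y, z)\<leftarrow>v. \<tau> x y z)"
proof (rule formal_sum_eq_sum_list[OF assms(2)])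
  have "\<tau> (0 + 0) b c = \<tau> 0 b c + \<tau> 0 b c" for b c
    using assms(1) unfolding balanced3_def balanced_def by blast
  then have zero: "\<tau> 0 b c = 0" for b c by simp
  show "(\<Sum>(x, y, z)\<leftarrow>u. \<tau> x y z) = (\<Sum>(x, y, z)\<leftarrow>v. \<tau> x y z)"
    if "trilinear_rel sA sB sC u v" for u v
    using that by cases (use assms(1) in \<open>auto simp: balanced3_def balanced_def zero\<close>)
qed

lemma (in vector_space) tensor_sum_scale:
  "tensor_sum u (\<lambda>x y. scale c (\<beta> x y)) = scale c (tensor_sum u \<beta>)"
  by (rule tensor_sum_additive[symmetric]) (rule scale_right_distrib)

lemma (in vector_space) tensor_sum_scale_left:
  "tensor_sum u (\<lambda>x y. scale (\<beta> x y) v) = scale (tensor_sum u \<beta>) v"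
  by (rule tensor_sum_additive[symmetric]) (rule scale_left_distrib)

lemma (in vector_space) tensor_sum_in_subspace:
  assumes "subspace W" "\<And>x y. (x, y) \<in> set u \<Longrightarrow> \<beta> x y \<in> W"
  shows "tensor_sum u \<beta> \<in> W"
  using assms(2)
  by (induction u) (auto simp: tensor_sum_def subspace_0[OF assms(1)] intro!: subspace_add[OF assms(1)])

lemma
  assumes "linear_to_tensor sX sA sB f" "balanced sA sB \<beta>"
  shows tensor_sum_linear_add: "tensor_sum (f (x + y)) \<beta> = tensor_sum (f x) \<beta> + tensor_sum (f y) \<beta>"
    and tensor_sum_linear_scale: "tensor_sum (f (sX c x)) \<beta> = tensor_sum (f x) (\<lambda>a b. \<beta> (sA c a) b)"
  using assms tensor_sum_eq[OF assms(2)]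
  unfolding linear_to_tensor_def by (metis tensor_sum_append tensor_sum_tensor_scale)+

lemma (in vector_space) tensor_sum_scale_mult:
  "tensor_sum u (\<lambda>x y. scale (c * f x y) (\<beta> x y)) = scale c (tensor_sum u (\<lambda>x y. scale (f x y) (\<beta> x y)))"
  "tensor_sum u (\<lambda>x y. scale (f x y * c) (\<beta> x y)) = scale c (tensor_sum u (\<lambda>x y. scale (f x y) (\<beta> x y)))"
  by (simp_all add: mult.commute flip: tensor_sum_scale)

lemma tensor_eq_generators:
  "tensor_eq sA sB [(a + a', b)] [(a, b), (a', b)]"
  "tensor_eq sA sB [(a, b + b')] [(a, b), (a, b')]"
  "tensor_eq sA sB [(sA c a, b)] [(a, sB c b)]"
  "tensor_eq sA sB [(a, sB c b)] [(sA c a, b)]"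
  "tensor_eq sA sB [(0, b)] []"
  by (rule formal_sum_eq.gen, rule bilinear_rel.intros)+
     (rule formal_sum_eq.sym, rule formal_sum_eq.gen, rule bilinear_rel.intros,
      rule formal_sum_eq.gen, rule bilinear_rel.intros)

lemma tensor_scale_cong:
  assumes "vector_space sA" and "tensor_eq sA sB u v"
  shows "tensor_eq sA sB (tensor_scale sA c u) (tensor_scale sA c v)"
  using assms(2)
proof induction
  case (gen u v)
  interpret A: vector_space sA by fact
  from gen show ?case
  proof cases
    case (3 k a b)
    then show ?thesis
      using tensor_eq_generators(3)[of sA sB k "sA c a" b]
      by (simp add: tensor_scale_def mult.commute)
  qed (auto simp: tensor_scale_def A.scale_right_distrib intro: tensor_eq_generators)
qed (auto simp: tensor_scale_def intro: formal_sum_eq.intros)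

context
  fixes sA :: "'f::field \<Rightarrow> 'a::ab_group_add \<Rightarrow> 'a" and sB :: "'f \<Rightarrow> 'b::ab_group_add \<Rightarrow> 'b"
  assumes sA: "vector_space sA" and sB: "vector_space sB"
begin

interpretation A: vector_space sA by (fact sA)
interpretation B: vector_space sB by (fact sB)

lemma tensor_eq_zero_list: "tensor_eq sA sB (map (\<lambda>b. (0, b)) bs) []"
proof (induction bs)
  case (Cons b bs)
  show ?case
    using formal_sum_eq.add[OF tensor_eq_generators(5)[of sA sB b] Cons] by simp
qed (simp add: formal_sum_eq.refl)

lemma tensor_eq_add_list:
  "tensor_eq sA sB (map (\<lambda>b. (f b + g b, b)) bs) (map (\<lambda>b. (f b, b)) bs @ map (\<lambda>b. (g b, b)) bs)"
proof (induction bs)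
  case (Cons b bs)
  let ?F = "map (\<lambda>b. (f b, b)) bs" and ?G = "map (\<lambda>b. (g b, b)) bs"
  have "tensor_eq sA sB ([(f b + g b, b)] @ map (\<lambda>b. (f b + g b, b)) bs) ([(f b, b), (g b, b)] @ ?F @ ?G)"
    by (intro formal_sum_eq.add Cons tensor_eq_generators)
  moreover have "tensor_eq sA sB ([(f b, b)] @ ([(g b, b)] @ ?F) @ ?G) ([(f b, b)] @ (?F @ [(g b, b)]) @ ?G)"
    by (intro formal_sum_eq.add formal_sum_eq.refl formal_sum_eq.comm)
  ultimately show ?case using formal_sum_eq.trans by fastforce
qed (simp add: formal_sum_eq.refl)

lemma tensor_eq_expand:
  "tensor_eq sA sB [(a, \<Sum>b\<leftarrow>bs. sB (c b) b)] (map (\<lambda>b. (sA (c b) a, b)) bs)"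
proof (induction bs)
  case Nil
  have "tensor_eq sA sB [(a, sB 0 0)] [(sA 0 a, 0)]"
    by (rule tensor_eq_generators)
  moreover have "tensor_eq sA sB [(0, 0)] []"
    by (rule tensor_eq_generators)
  ultimately show ?case by (auto intro: formal_sum_eq.trans)
next
  case (Cons b bs)
  let ?r = "\<Sum>b\<leftarrow>bs. sB (c b) b"
  have "tensor_eq sA sB [(a, sB (c b) b + ?r)] ([(a, sB (c b) b)] @ [(a, ?r)])"
    using tensor_eq_generators(2) by simp
  moreover have "tensor_eq sA sB ([(a, sB (c b) b)] @ [(a, ?r)])
      ([(sA (c b) a, b)] @ map (\<lambda>b. (sA (c b) a, b)) bs)"
    by (intro formal_sum_eq.add Cons tensor_eq_generators)
  ultimately show ?case using formal_sum_eq.trans by fastforce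
qed

text \<open>
  Every tensor has a representative \<open>\<Sum>\<^sub>b (id \<otimes> b*)(u) \<otimes> b\<close>, where \<open>b\<close> runs through a basis and \<open>b*\<close>
  through the coordinate functionals.
\<close>

lemma tensor_eq_basis:
  assumes "\<And>h. h = (\<Sum>b\<leftarrow>bs. sB (c b h) b)"
  shows "tensor_eq sA sB u (map (\<lambda>b. (tensor_sum u (\<lambda>a h. sA (c b h) a), b)) bs)"
proof (induction u)
  case Nil
  then show ?case using tensor_eq_zero_list by (simp add: tensor_sum_def formal_sum_eq.sym)
next
  case (Cons p u)
  obtain a h where p: "p = (a, h)" by (cases p)
  let ?g = "\<lambda>b. tensor_sum u (\<lambda>a h. sA (c b h) a)"
  have "tensor_eq sA sB [(a, h)] (map (\<lambda>b. (sA (c b h) a, b)) bs)"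
    using tensor_eq_expand[of a "\<lambda>b. c b h" bs] assms[of h] by simp
  from formal_sum_eq.add[OF this Cons]
  have "tensor_eq sA sB ([(a, h)] @ u)
      (map (\<lambda>b. (sA (c b h) a, b)) bs @ map (\<lambda>b. (?g b, b)) bs)" .
  from formal_sum_eq.trans[OF this formal_sum_eq.sym[OF tensor_eq_add_list]]
  show ?case by (simp add: p tensor_sum_def)
qed

end

section \<open>Sweedler calculus in a Hopf algebra\<close>

context coalgebra
begin

lemma comult_add:
  assumes "balanced scale scale \<beta>"
  shows "tensor_sum (\<Delta> (x + y)) \<beta> = tensor_sum (\<Delta> x) \<beta> + tensor_sum (\<Delta> y) \<beta>"
  by (rule tensor_sum_linear_add[OF comult_linear assms])

lemma comult_scale:
  assumes "balanced scale scale \<beta>"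
  shows "tensor_sum (\<Delta> (scale c x)) \<beta> = tensor_sum (\<Delta> x) (\<lambda>a b. \<beta> (scale c a) b)"
  by (rule tensor_sum_linear_scale[OF comult_linear assms])

lemma counit_add: "\<epsilon> (x + y) = \<epsilon> x + \<epsilon> y"
  and counit_scale: "\<epsilon> (scale c x) = c * \<epsilon> x"
  using counit_linear by (simp_all add: Vector_Spaces.linear_iff)

lemma comult_coassoc:
  assumes "balanced3 scale scale scale \<tau>"
  shows "tensor_sum (\<Delta> h) (\<lambda>x y. tensor_sum (\<Delta> x) (\<lambda>x1 x2. \<tau> x1 x2 y)) =
    tensor_sum (\<Delta> h) (\<lambda>x y. tensor_sum (\<Delta> y) (\<lambda>y1 y2. \<tau> x y1 y2))"
  using tensor3_sum_eq[OF assms coassoc[of h]]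
  by (simp add: tensor_sum_concat) (simp add: tensor_sum_def split_def comp_def)

lemma counit_left_sum: "tensor_sum (\<Delta> h) (\<lambda>x y. scale (\<epsilon> x) y) = h"
  and counit_right_sum: "tensor_sum (\<Delta> h) (\<lambda>x y. scale (\<epsilon> y) x) = h"
  using counit_left counit_right by (simp_all add: tensor_sum_def)

end

context bialgebra
begin

lemma comult_mult_sum:
  assumes "balanced scale scale \<beta>"
  shows "tensor_sum (\<Delta> (h * k)) \<beta> =
    tensor_sum (\<Delta> h) (\<lambda>x y. tensor_sum (\<Delta> k) (\<lambda>x' y'. \<beta> (x * x') (y * y')))"
  using tensor_sum_eq[OF assms comult_mult[of h k]]
  by (simp add: tensor_sum_concat_tensor tensor_sum_map)

lemma comult_one_sum: "balanced scale scale \<beta> \<Longrightarrow> tensor_sum (\<Delta> 1) \<beta> = \<beta> 1 1"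
  using tensor_sum_eq[OF _ comult_one] by (simp add: tensor_sum_def)

end

context hopf_algebra
begin

lemma antipode_add: "S (x + y) = S x + S y"
  and antipode_scale: "S (scale c x) = scale c (S x)"
  using antipode_linear by (simp_all add: Vector_Spaces.linear_iff)

lemma antipode_left_sum: "tensor_sum (\<Delta> h) (\<lambda>x y. S x * y) = scale (\<epsilon> h) 1"
  and antipode_right_sum: "tensor_sum (\<Delta> h) (\<lambda>x y. x * S y) = scale (\<epsilon> h) 1"
  using antipode_left antipode_right by (simp_all add: tensor_sum_def)

text \<open>
  When the last variable of a Sweedler sum is the right factor of its product, it disappears by
  eta-contraction and the distributive laws no longer match; these are their contracted forms.
\<close>

lemma eta_mult: "(*) (a + b) = (\<lambda>z. a * z + b * z)" "(*) (scale c a) = (\<lambda>z. scale c (a * z))"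
  for a b :: 'h
  by (auto simp: distrib_right scale_mult_left)

lemmas multilinear_simps =
  antipode_add antipode_scale counit_add counit_scale comult_add comult_scale
  tensor_sum_add tensor_sum_scale distrib_left distrib_right scale_mult_left scale_mult_right
  scale_right_distrib scale_left_distrib balanced_def balanced3_def mult.commute
  eta_mult

text \<open>
  Insert \<open>\<epsilon>(x\<^sub>1) 1 = S(x\<^sub>1) x\<^sub>2\<close> in front; by multiplicativity of \<open>\<Delta>\<close> what follows \<open>S(x\<^sub>1)\<close> is then
  \<open>(x\<^sub>2 h)\<^sub>1 S((x\<^sub>2 h)\<^sub>2) = \<epsilon>(x\<^sub>2) \<epsilon>(h) 1\<close>. This identity takes the place of the antimultiplicativity of the
  antipode.
\<close>

lemma comult_antipode_absorb_left:
  "tensor_sum (\<Delta> h) (\<lambda>h1 h2. h1 * S (x * h2)) = scale (\<epsilon> h) (S x)"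
proof -
  let ?f = "\<lambda>x. tensor_sum (\<Delta> h) (\<lambda>h1 h2. h1 * S (x * h2))"
  have "?f x = tensor_sum (\<Delta> x) (\<lambda>x1 x2. ?f (scale (\<epsilon> x1) x2))"
    by (subst counit_left_sum[of x, symmetric], rule tensor_sum_additive)
       (simp add: multilinear_simps)
  also have "\<dots> = tensor_sum (\<Delta> x) (\<lambda>x1 x2. scale (\<epsilon> x1) 1 * ?f x2)"
    by (simp add: multilinear_simps)
  also have "\<dots> = tensor_sum (\<Delta> x) (\<lambda>x1 x2. tensor_sum (\<Delta> x1) (\<lambda>p q. S p * q * ?f x2))"
    by (simp add: antipode_left_sum tensor_sum_mult_right)
  also have "\<dots> = tensor_sum (\<Delta> x) (\<lambda>p r. tensor_sum (\<Delta> r) (\<lambda>q x2. S p * q * ?f x2))"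
    by (rule comult_coassoc) (simp add: multilinear_simps)
  also have "\<dots> = tensor_sum (\<Delta> x) (\<lambda>p r. S p * tensor_sum (\<Delta> (r * h)) (\<lambda>a b. a * S b))"
    by (subst comult_mult_sum) (simp_all add: multilinear_simps mult.assoc tensor_sum_mult_left)
  also have "\<dots> = tensor_sum (\<Delta> x) (\<lambda>p r. scale (\<epsilon> h) (S (scale (\<epsilon> r) p)))"
    by (simp add: antipode_right_sum counit_mult multilinear_simps mult.commute)
  also have "\<dots> = scale (\<epsilon> h) (S (tensor_sum (\<Delta> x) (\<lambda>p r. scale (\<epsilon> r) p)))"
    by (rule tensor_sum_additive[symmetric]) (simp add: multilinear_simps)
  finally show ?thesis by (simp add: counit_right_sum)
qed

text \<open>
  The mirror image: insert \<open>\<epsilon>(x\<^sub>2) 1 = x\<^sub>2 S(x\<^sub>3)\<close> at the end.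
\<close>

lemma comult_antipode_absorb_right:
  "tensor_sum (\<Delta> h) (\<lambda>h1 h2. S (h1 * x) * h2) = scale (\<epsilon> h) (S x)"
proof -
  let ?f = "\<lambda>x. tensor_sum (\<Delta> h) (\<lambda>h1 h2. S (h1 * x) * h2)"
  have "?f x = tensor_sum (\<Delta> x) (\<lambda>x1 x2. ?f (scale (\<epsilon> x2) x1))"
    by (subst counit_right_sum[of x, symmetric], rule tensor_sum_additive)
       (simp add: multilinear_simps)
  also have "\<dots> = tensor_sum (\<Delta> x) (\<lambda>x1 x2. ?f x1 * scale (\<epsilon> x2) 1)"
    by (simp add: multilinear_simps)
  also have "\<dots> = tensor_sum (\<Delta> x) (\<lambda>x1 x2. tensor_sum (\<Delta> x2) (\<lambda>p q. ?f x1 * p * S q))"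
    by (simp add: antipode_right_sum[symmetric] tensor_sum_mult_left mult.assoc)
  also have "\<dots> = tensor_sum (\<Delta> x) (\<lambda>r q. tensor_sum (\<Delta> r) (\<lambda>x1 p. ?f x1 * p * S q))"
    by (rule comult_coassoc[symmetric]) (simp add: multilinear_simps)
  also have "\<dots> = tensor_sum (\<Delta> x) (\<lambda>r q. tensor_sum (\<Delta> (h * r)) (\<lambda>a b. S a * b) * S q)"
  proof (rule tensor_sum_cong)
    fix r q
    have "tensor_sum (\<Delta> (h * r)) (\<lambda>a b. S a * b) = tensor_sum (\<Delta> r) (\<lambda>x1 p. ?f x1 * p)"
      by (subst comult_mult_sum, simp add: multilinear_simps, subst tensor_sum_swap)
         (simp add: mult.assoc[symmetric] tensor_sum_mult_right)
    then show "tensor_sum (\<Delta> r) (\<lambda>x1 p. ?f x1 * p * S q) =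
        tensor_sum (\<Delta> (h * r)) (\<lambda>a b. S a * b) * S q"
      by (simp add: tensor_sum_mult_right)
  qed
  also have "\<dots> = tensor_sum (\<Delta> x) (\<lambda>r q. scale (\<epsilon> h) (S (scale (\<epsilon> r) q)))"
    by (simp add: antipode_left_sum counit_mult multilinear_simps mult.commute)
  also have "\<dots> = scale (\<epsilon> h) (S (tensor_sum (\<Delta> x) (\<lambda>r q. scale (\<epsilon> r) q)))"
    by (rule tensor_sum_additive[symmetric]) (simp add: multilinear_simps)
  finally show ?thesis by (simp add: counit_left_sum)
qed

text \<open>
  In Sweedler notation \<open>S(x\<^sub>2)\<^sub>1 \<otimes> x\<^sub>1 S(x\<^sub>2)\<^sub>2 = S(x) \<otimes> 1\<close>, evaluated by a bilinear \<open>\<beta>\<close>. Inserting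
  \<open>S(x\<^sub>1) x\<^sub>2\<close> into the left tensor factor turns the left-hand side into \<open>(S(x\<^sub>1) \<otimes> 1) \<Delta>(x\<^sub>2 S(x\<^sub>3))\<close>. This
  takes the place of the anticomultiplicativity of the antipode.
\<close>

lemma comult_antipode_cancel:
  assumes \<beta>: "balanced scale scale \<beta>"
  shows "tensor_sum (\<Delta> x) (\<lambda>x1 x2. tensor_sum (\<Delta> (S x2)) (\<lambda>y z. \<beta> y (x1 * z))) = \<beta> (S x) 1"
proof -
  have \<beta>_simps: "\<beta> (a + a') b = \<beta> a b + \<beta> a' b" "\<beta> a (b + b') = \<beta> a b + \<beta> a b'"
    "\<beta> a (scale c b) = \<beta> (scale c a) b" for a a' b b' c
    using \<beta> by (auto simp: balanced_def)
  define f where "f a q x2 = tensor_sum (\<Delta> (S x2)) (\<lambda>y z. \<beta> (a * y) (q * z))" for a q x2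
  have f_simps: "f (a + a') q x2 = f a q x2 + f a' q x2" "f a (q + q') x2 = f a q x2 + f a q' x2"
    "f a q (x2 + x2') = f a q x2 + f a q x2'"
    "f a (scale c q) x2 = f (scale c a) q x2" "f a q (scale c x2) = f (scale c a) q x2"
    for a a' q q' x2 x2' c
    by (simp_all add: f_def multilinear_simps \<beta>_simps)
  have "tensor_sum (\<Delta> x) (\<lambda>x1 x2. tensor_sum (\<Delta> (S x2)) (\<lambda>y z. \<beta> y (x1 * z))) =
    tensor_sum (\<Delta> x) (\<lambda>x1 x2. f 1 x1 x2)"
    by (simp add: f_def)
  also have "\<dots> = tensor_sum (\<Delta> x) (\<lambda>x1 x2. tensor_sum (\<Delta> x1) (\<lambda>p q. f (scale (\<epsilon> p) 1) q x2))"
  proof (rule tensor_sum_cong)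
    fix x1 x2
    show "f 1 x1 x2 = tensor_sum (\<Delta> x1) (\<lambda>p q. f (scale (\<epsilon> p) 1) q x2)"
      by (subst counit_left_sum[of x1, symmetric], subst tensor_sum_additive[where F = "\<lambda>q. f 1 q x2"])
         (simp_all add: f_simps)
  qed
  also have "\<dots> = tensor_sum (\<Delta> x) (\<lambda>x1 x2. tensor_sum (\<Delta> x1) (\<lambda>p q.
      tensor_sum (\<Delta> p) (\<lambda>p1 p2. f (S p1 * p2) q x2)))"
    by (simp add: antipode_left_sum[symmetric] tensor_sum_additive[where F = "\<lambda>a. f a _ _"] f_simps)
  also have "\<dots> = tensor_sum (\<Delta> x) (\<lambda>x1 x2. tensor_sum (\<Delta> x1) (\<lambda>p r.
      tensor_sum (\<Delta> r) (\<lambda>p2 q. f (S p * p2) q x2)))"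
    by (intro tensor_sum_cong comult_coassoc) (simp add: multilinear_simps f_simps)
  also have "\<dots> = tensor_sum (\<Delta> x) (\<lambda>p t. tensor_sum (\<Delta> t) (\<lambda>r x2.
      tensor_sum (\<Delta> r) (\<lambda>p2 q. f (S p * p2) q x2)))"
    by (rule comult_coassoc) (simp add: multilinear_simps f_simps)
  also have "\<dots> = tensor_sum (\<Delta> x) (\<lambda>p t. tensor_sum (\<Delta> t) (\<lambda>r x2.
      tensor_sum (\<Delta> (r * S x2)) (\<lambda>a b. \<beta> (S p * a) b)))"
    by (simp add: comult_mult_sum multilinear_simps \<beta>_simps f_def mult.assoc)
  also have "\<dots> = tensor_sum (\<Delta> x) (\<lambda>p t. tensor_sum (\<Delta> (scale (\<epsilon> t) 1)) (\<lambda>a b. \<beta> (S p * a) b))"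
    by (simp add: antipode_right_sum[symmetric] multilinear_simps \<beta>_simps
        tensor_sum_additive[where F = "\<lambda>x. tensor_sum (\<Delta> x) (\<lambda>a b. \<beta> (S _ * a) b)"])
  also have "\<dots> = tensor_sum (\<Delta> x) (\<lambda>p t. \<beta> (S (scale (\<epsilon> t) p)) 1)"
    by (simp add: comult_one_sum multilinear_simps \<beta>_simps)
  also have "\<dots> = \<beta> (S (tensor_sum (\<Delta> x) (\<lambda>p t. scale (\<epsilon> t) p))) 1"
    by (rule tensor_sum_additive[symmetric]) (simp add: multilinear_simps \<beta>_simps)
  finally show ?thesis by (simp add: counit_right_sum)
qed

end

section \<open>Integrals and cointegrals\<close>

context hopf_algebra
begin

text \<open>
  A projection \<open>p\<close> of the regular module onto \<open>ker \<epsilon>\<close> is right multiplication by \<open>p 1\<close>, so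
  \<open>t = 1 - p 1\<close> is annihilated from the left by \<open>ker \<epsilon>\<close> and satisfies \<open>\<epsilon> t = 1\<close>. The averaging needs
  the other side: for \<open>k \<in> ker \<epsilon>\<close> the element \<open>j = t k\<close> spans a left ideal with \<open>j\<^sup>2 = 0\<close>, and a
  semisimple algebra has no such nonzero ideal.
\<close>

lemma semisimple_imp_integral:
  assumes "finite_dimensional_vector_space scale Basis" and "semisimple scale"
  obtains t where "\<epsilon> t = 1" "\<And>h. t * h = scale (\<epsilon> h) t"
proof -
  interpret mult: operator_space scale Basis "range (*)"
  proof (intro operator_space.intro operator_space_axioms.intro assms(1))
    show "Vector_Spaces.linear scale scale t" if "t \<in> range (*)" for t
      using that by (auto simp: Vector_Spaces.linear_iff vector_space_axioms distrib_left scale_mult_right)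
  qed
  have red: "completely_reducible mult.invariant"
    using assms(2) by (simp add: semisimple_def left_ideal_def[abs_def] invariant_subspace_def[abs_def])
  have \<epsilon>_diff: "\<epsilon> (x - y) = \<epsilon> x - \<epsilon> y" for x y
    using counit_add[of "x - y" y] by simp
  have "mult.invariant {h. \<epsilon> h = 0}"
    using counit_scale[of 0 0]
    by (auto simp: invariant_subspace_def subspace_def counit_add counit_scale counit_mult)
  from mult.completely_reducible_imp_projection[OF red this]
  obtain p where p: "commuting_projection scale (range (*)) {h. \<epsilon> h = 0} p" .
  define t where "t = 1 - p 1"
  have \<epsilon>p: "\<epsilon> (p 1) = 0" using p by (auto simp: commuting_projection_def)
  then have t1: "\<epsilon> t = 1" by (simp add: t_def \<epsilon>_diff counit_one)
  have ker: "h * t = 0" if "\<epsilon> h = 0" for h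
  proof -
    have "p h = h * p 1" using p unfolding commuting_projection_def by (metis mult.right_neutral rangeI)
    moreover have "p h = h" using p that by (simp add: commuting_projection_def)
    ultimately show ?thesis by (simp add: t_def right_diff_distrib)
  qed
  have left: "h * t = scale (\<epsilon> h) t" for h
  proof -
    have "(h - scale (\<epsilon> h) 1) * t = 0" by (rule ker) (simp add: \<epsilon>_diff counit_scale counit_one)
    then show ?thesis by (simp add: left_diff_distrib scale_mult_left)
  qed
  have ker': "t * k = 0" if k: "\<epsilon> k = 0" for k
  proof -
    define j where "j = t * k"
    have hj: "h * j = scale (\<epsilon> h) j" for h
      using left[of h] by (simp add: j_def mult.assoc[symmetric] scale_mult_left)
    have "\<epsilon> j = 0" by (simp add: j_def counit_mult k)
    then have jj: "j * j = 0" using hj[of j] by simp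
    have "mult.invariant (range (\<lambda>c. scale c j))"
      unfolding invariant_subspace_def
    proof (intro conjI ballI)
      show "subspace (range (\<lambda>c. scale c j))"
        by (rule subspaceI) (auto simp: scale_left_distrib[symmetric] intro: rangeI[of _ 0, simplified])
      fix f :: "'h \<Rightarrow> 'h" and w assume "f \<in> range (*)" "w \<in> range (\<lambda>c. scale c j)"
      then show "f w \<in> range (\<lambda>c. scale c j)" by (auto simp: scale_mult_right hj)
    qed
    \<comment> \<open>The projection onto the line of \<open>j\<close> maps \<open>j\<close> to \<open>j * q 1\<close>, a multiple of \<open>j * j = 0\<close>.\<close>
    from mult.completely_reducible_imp_projection[OF red this]
    obtain q where q: "commuting_projection scale (range (*)) (range (\<lambda>c. scale c j)) q" .
    obtain c where "q 1 = scale c j" using q unfolding commuting_projection_def by blast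
    then have "j * q 1 = 0" by (simp add: scale_mult_right jj)
    moreover have "q j = j * q 1"
      using q unfolding commuting_projection_def by (metis mult.right_neutral rangeI)
    moreover have "q j = j" using q unfolding commuting_projection_def by (metis rangeI scale_one)
    ultimately show ?thesis by (simp add: j_def)
  qed
  have right: "t * h = scale (\<epsilon> h) t" for h
  proof -
    have "t * (h - scale (\<epsilon> h) 1) = 0" by (rule ker') (simp add: \<epsilon>_diff counit_scale counit_one)
    then show ?thesis by (simp add: right_diff_distrib scale_mult_right)
  qed
  show ?thesis using that t1 right by blast
qed

lemma line_one_subcoalgebra: "subcoalgebra scale \<Delta> (range (\<lambda>c. scale c 1))"
  unfolding subcoalgebra_def
proof (intro conjI ballI)
  show "subspace (range (\<lambda>c. scale c 1))"
    by (rule subspaceI) (auto simp: scale_left_distrib[symmetric] intro: rangeI[of _ 0, simplified])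
  fix x assume "x \<in> range (\<lambda>c. scale c 1)"
  then obtain c where x: "x = scale c 1" by blast
  have "tensor_eq scale scale (\<Delta> x) (tensor_scale scale c (\<Delta> 1))"
    using comult_linear by (simp add: linear_to_tensor_def x)
  moreover have "tensor_eq scale scale (tensor_scale scale c (\<Delta> 1)) (tensor_scale scale c [(1, 1)])"
    by (rule tensor_scale_cong[OF vector_space_axioms comult_one])
  ultimately have "tensor_eq scale scale (\<Delta> x) [(scale c 1, 1)]"
    by (simp add: tensor_scale_def formal_sum_eq.trans)
  moreover have "1 \<in> range (\<lambda>c. scale c 1)" by (rule range_eqI[of _ _ 1]) simp
  ultimately show "\<exists>u. set u \<subseteq> range (\<lambda>c. scale c 1) \<times> range (\<lambda>c. scale c 1) \<and>
      tensor_eq scale scale (\<Delta> x) u"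
    by (intro exI[of _ "[(scale c 1, 1)]"]) auto
qed

lemma subcoalgebra_sum_zero:
  assumes "subcoalgebra scale \<Delta> C" "h \<in> C" "balanced scale scale \<beta>"
    and "\<And>x y. x \<in> C \<Longrightarrow> y \<in> C \<Longrightarrow> \<beta> x y = 0"
  shows "tensor_sum (\<Delta> h) \<beta> = 0"
proof -
  obtain u where u: "set u \<subseteq> C \<times> C" "tensor_eq scale scale (\<Delta> h) u"
    using assms(1,2) by (auto simp: subcoalgebra_def)
  have "tensor_sum (\<Delta> h) \<beta> = tensor_sum u (\<lambda>x y. 0)"
    unfolding tensor_sum_eq[OF assms(3) u(2)] by (rule tensor_sum_cong) (use u(1) assms(4) in auto)
  then show ?thesis by (simp add: tensor_sum_zero)
qed

lemma comult_sum:
  assumes "balanced scale scale \<beta>"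
  shows "tensor_sum (\<Delta> (\<Sum>k\<in>I. x k)) \<beta> = (\<Sum>k\<in>I. tensor_sum (\<Delta> (x k)) \<beta>)"
proof -
  have "tensor_sum (\<Delta> 0) \<beta> = 0" using comult_add[OF assms, of 0 0] by simp
  then show ?thesis
    by (induction I rule: infinite_finite_induct) (simp_all add: comult_add[OF assms])
qed

text \<open>
  The line spanned by \<open>1\<close> is one of the simple summands: some component of \<open>1\<close> has nonzero counit, and
  the mixed components of \<open>\<Delta> 1 = 1 \<otimes> 1\<close> vanish because every summand is a subcoalgebra, so \<open>1\<close> has
  no other component. The functional \<open>l\<close> is the coordinate along this line. It kills the other
  summands \<open>C\<close>, and \<open>\<Delta> C \<subseteq> C \<otimes> C\<close> gives the identity on them.
\<close>

lemma cosemisimple_imp_cointegral: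
  assumes "cosemisimple scale \<Delta>"
  obtains l where "Vector_Spaces.linear scale (*) l" "l 1 = 1"
    "\<And>h. tensor_sum (\<Delta> h) (\<lambda>x y. scale (l x) y) = scale (l h) 1"
proof -
  obtain s X where irr: "\<And>k. k \<in> {1..s} \<Longrightarrow> irreducible_sub (subcoalgebra scale \<Delta>) (X k)"
    and dsd: "direct_sum_decomposition s X"
    using assms unfolding cosemisimple_def completely_reducible_def by blast
  have sub: "subcoalgebra scale \<Delta> (X k)" if "k \<in> {1..s}" for k
    using irr[OF that] by (simp add: irreducible_sub_def)
  have "subspace (X k)" if "k \<in> {1..s}" for k
    using sub[OF that] by (simp add: subcoalgebra_def)
  from direct_sum_projections[OF vector_space_axioms dsd this]
  obtain \<pi> where lin: "\<And>i. i \<in> {1..s} \<Longrightarrow> Vector_Spaces.linear scale scale (\<pi> i)"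
    and in_X: "\<And>i v. i \<in> {1..s} \<Longrightarrow> \<pi> i v \<in> X i"
    and sum_\<pi>: "\<And>v. v = (\<Sum>i=1..s. \<pi> i v)"
    and \<pi>_X: "\<And>i j v. i \<in> {1..s} \<Longrightarrow> j \<in> {1..s} \<Longrightarrow> v \<in> X j \<Longrightarrow> \<pi> i v = (if i = j then v else 0)"
    by blast
  have \<epsilon>0: "\<epsilon> 0 = 0" using counit_scale[of 0 0] by simp
  have \<epsilon>_sum: "\<epsilon> (\<Sum>k\<in>I. x k) = (\<Sum>k\<in>I. \<epsilon> (x k))" for I :: "nat set" and x
    by (induction I rule: infinite_finite_induct) (simp_all add: counit_add \<epsilon>0)
  have "(\<Sum>k=1..s. \<epsilon> (\<pi> k 1)) = 1"
    using counit_one sum_\<pi>[of 1] by (simp add: \<epsilon>_sum[symmetric])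
  then obtain i where i: "i \<in> {1..s}" "\<epsilon> (\<pi> i 1) \<noteq> 0"
    by (metis sum.neutral zero_neq_one)
  have \<pi>_simps: "\<pi> k (x + y) = \<pi> k x + \<pi> k y" "\<pi> k (scale c x) = scale c (\<pi> k x)"
    if "k \<in> {1..s}" for k x y c
    using lin[OF that] by (simp_all add: Vector_Spaces.linear_iff)
  have others: "\<pi> j 1 = 0" if j: "j \<in> {1..s}" "j \<noteq> i" for j
  proof -
    define \<beta> where "\<beta> x y = scale (\<epsilon> (\<pi> i x)) (\<pi> j y)" for x y
    have \<beta>: "balanced scale scale \<beta>"
      by (simp add: \<beta>_def balanced_def \<pi>_simps[OF i(1)] \<pi>_simps[OF j(1)] counit_add counit_scale
          scale_left_distrib scale_right_distrib mult.commute)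
    have "tensor_sum (\<Delta> (\<pi> k 1)) \<beta> = 0" if k: "k \<in> {1..s}" for k
      by (rule subcoalgebra_sum_zero[OF sub[OF k] in_X[OF k] \<beta>])
         (use k i j in \<open>auto simp: \<beta>_def \<pi>_X \<epsilon>0\<close>)
    then have "tensor_sum (\<Delta> (\<Sum>k=1..s. \<pi> k 1)) \<beta> = 0" by (simp add: comult_sum[OF \<beta>])
    then have "tensor_sum (\<Delta> 1) \<beta> = 0" using sum_\<pi>[of 1] by simp
    then show ?thesis using i(2) by (simp add: comult_one_sum[OF \<beta>] \<beta>_def)
  qed
  have "(\<Sum>k=1..s. \<pi> k 1) = (\<Sum>k=1..s. if k = i then \<pi> k 1 else 0)"
    by (rule sum.cong) (use others in auto)
  also have "\<dots> = \<pi> i 1" using i(1) by simp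
  finally have one: "1 = \<pi> i 1" using sum_\<pi>[of 1] by metis
  then have "1 \<in> X i" using in_X[OF i(1)] by metis
  then have "range (\<lambda>c. scale c 1) \<subseteq> X i"
    using sub[OF i(1)] by (auto simp: subcoalgebra_def subspace_scale)
  moreover have "1 \<in> range (\<lambda>c. scale c 1)" by (rule range_eqI[of _ _ 1]) simp
  then have "range (\<lambda>c. scale c 1) \<noteq> {0}" by (metis singletonD zero_neq_one)
  ultimately have Xi: "X i = range (\<lambda>c. scale c 1)"
    using irr[OF i(1)] line_one_subcoalgebra unfolding irreducible_sub_def by metis
  \<comment> \<open>As \<open>\<epsilon> 1 = 1\<close>, the counit reads off the coordinate of a multiple of \<open>1\<close>.\<close>
  define l where "l h = \<epsilon> (\<pi> i h)" for h
  have l_simps: "l (x + y) = l x + l y" "l (scale c x) = c * l x" for x y c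
    by (simp_all add: l_def \<pi>_simps[OF i(1)] counit_add counit_scale)
  have l1: "l 1 = 1" using one counit_one by (simp add: l_def)
  have bal: "balanced scale scale (\<lambda>x y. scale (l x) y)"
    by (simp add: balanced_def l_simps scale_left_distrib scale_right_distrib mult.commute)
  have on_X: "tensor_sum (\<Delta> h) (\<lambda>x y. scale (l x) y) = scale (l h) 1" if k: "k \<in> {1..s}" "h \<in> X k" for h k
  proof (cases "k = i")
    case True
    then obtain c where h: "h = scale c 1" using k(2) Xi by blast
    show ?thesis
      using comult_one_sum[OF bal]
      by (simp add: h comult_scale[OF bal] l_simps tensor_sum_scale l1 flip: scale_scale)
  next
    case False
    then have "l h = 0" using k i by (simp add: l_def \<pi>_X \<epsilon>0)
    moreover have "tensor_sum (\<Delta> h) (\<lambda>x y. scale (l x) y) = 0"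
      by (rule subcoalgebra_sum_zero[OF sub[OF k(1)] k(2) bal])
         (use False k i in \<open>auto simp: l_def \<pi>_X \<epsilon>0\<close>)
    ultimately show ?thesis by simp
  qed
  have l0: "l 0 = 0" using l_simps(2)[of 0 0] by simp
  have l_sum: "l (\<Sum>k\<in>I. x k) = (\<Sum>k\<in>I. l (x k))" for I :: "nat set" and x
    by (induction I rule: infinite_finite_induct) (simp_all add: l_simps l0)
  have "tensor_sum (\<Delta> h) (\<lambda>x y. scale (l x) y) = scale (l h) 1" for h
  proof -
    have "tensor_sum (\<Delta> (\<Sum>k=1..s. \<pi> k h)) (\<lambda>x y. scale (l x) y) = scale (l (\<Sum>k=1..s. \<pi> k h)) 1"
      using on_X in_X by (simp add: comult_sum[OF bal] l_sum scale_sum_left)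
    then show ?thesis using sum_\<pi>[of h] by simp
  qed
  moreover have "Vector_Spaces.linear scale (*) l"
    using counit_linear by (simp add: Vector_Spaces.linear_iff l_simps)
  ultimately show ?thesis using that l1 by blast
qed

text \<open>
  Expand \<open>l(z) 1 = l(z\<^sub>1) z\<^sub>2\<close> at \<open>z = S(x\<^sub>2) y\<close>; then \<open>x\<^sub>1\<close> cancels against \<open>S(x\<^sub>2)\<^sub>2\<close> by
  \<open>comult_antipode_cancel\<close>.
\<close>

lemma cointegral_antipode:
  assumes l_lin: "Vector_Spaces.linear scale (*) l"
    and l: "\<And>h. tensor_sum (\<Delta> h) (\<lambda>x y. scale (l x) y) = scale (l h) 1"
  shows "tensor_sum (\<Delta> x) (\<lambda>x1 x2. scale (l (S x2 * y)) x1) =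
    tensor_sum (\<Delta> y) (\<lambda>y1 y2. scale (l (S x * y1)) y2)"
proof -
  have l_simps: "l (x + y) = l x + l y" "l (scale c x) = c * l x" for x y c
    using l_lin by (simp_all add: Vector_Spaces.linear_iff)
  define \<beta> where "\<beta> a b = tensor_sum (\<Delta> y) (\<lambda>y1 y2. scale (l (a * y1)) (b * y2))" for a b
  have \<beta>: "balanced scale scale \<beta>"
    by (simp add: \<beta>_def multilinear_simps l_simps)
  have "tensor_sum (\<Delta> x) (\<lambda>x1 x2. scale (l (S x2 * y)) x1) =
    tensor_sum (\<Delta> x) (\<lambda>x1 x2. x1 * scale (l (S x2 * y)) 1)"
    by (simp add: scale_mult_right)
  also have "\<dots> = tensor_sum (\<Delta> x) (\<lambda>x1 x2. tensor_sum (\<Delta> (S x2 * y)) (\<lambda>a b. scale (l a) (x1 * b)))"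
    by (simp only: l[symmetric] tensor_sum_mult_left[symmetric] scale_mult_right)
  also have "\<dots> = tensor_sum (\<Delta> x) (\<lambda>x1 x2. tensor_sum (\<Delta> (S x2)) (\<lambda>a b. \<beta> a (x1 * b)))"
    by (simp add: comult_mult_sum multilinear_simps l_simps \<beta>_def mult.assoc)
  also have "\<dots> = \<beta> (S x) 1" by (rule comult_antipode_cancel[OF \<beta>])
  finally show ?thesis by (simp add: \<beta>_def)
qed

end

section \<open>Averaging over an integral: the module case\<close>

context module_HL_module
begin

lemma act_simps:
  "actV (h + k) v = actV h v + actV k v" "actV h (v + w) = actV h v + actV h w"
  "actV (scaleH c h) v = scaleV c (actV h v)" "actV h (scaleV c v) = scaleV c (actV h v)"
  "actL (h + k) a = actL h a + actL k a" "actL h (a + b) = actL h a + actL h b"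
  "actL (scaleH c h) a = scaleL c (actL h a)" "actL h (scaleL c a) = scaleL c (actL h a)"
  "\<psi> (a + b) v = \<psi> a v + \<psi> b v" "\<psi> a (v + w) = \<psi> a v + \<psi> a w"
  "\<psi> (scaleL c a) v = scaleV c (\<psi> a v)" "\<psi> a (scaleV c v) = scaleV c (\<psi> a v)"
  "actV 1 v = v" "actV (h * k) v = actV h (actV k v)"
  using V.act_bilinear L.act_bilinear rep.rep_bilinear V.act_one V.act_mult
  by (auto simp: bilinear_map_def Vector_Spaces.linear_iff)

lemmas multi_simps = multilinear_simps act_simps rep.V.tensor_sum_scale
  rep.V.scale_right_distrib rep.V.scale_left_distrib

lemma act_tensor_sum_left: "actV (tensor_sum u \<beta>) v = tensor_sum u (\<lambda>x y. actV (\<beta> x y) v)"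
  by (rule tensor_sum_additive) (simp add: act_simps)

lemma act_tensor_sum: "actV h (tensor_sum u \<beta>) = tensor_sum u (\<lambda>x y. actV h (\<beta> x y))"
  by (rule tensor_sum_additive) (simp add: act_simps)

lemma rep_tensor_sum: "\<psi> a (tensor_sum u \<beta>) = tensor_sum u (\<lambda>x y. \<psi> a (\<beta> x y))"
  by (rule tensor_sum_additive) (simp add: act_simps)

lemma act_rep_sum: "actV h (\<psi> a v) = tensor_sum (\<Delta> h) (\<lambda>x y. \<psi> (actL x a) (actV y v))"
  by (simp add: act_rep tensor_sum_def)

text \<open>
  In the smash product, \<open>h\<^sub>1 \<psi>(a) S(h\<^sub>2) = \<psi>(h a)\<close>: the action of \<open>H\<close> on \<open>L\<close> is the adjoint one.
\<close>

lemma rep_smash_antipode: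
  "tensor_sum (\<Delta> h) (\<lambda>q y. actV q (\<psi> a (actV (S y) w))) = \<psi> (actL h a) w"
proof -
  have "tensor_sum (\<Delta> h) (\<lambda>q y. actV q (\<psi> a (actV (S y) w))) =
    tensor_sum (\<Delta> h) (\<lambda>q y. tensor_sum (\<Delta> q) (\<lambda>q1 q2. \<psi> (actL q1 a) (actV (q2 * S y) w)))"
    by (simp add: act_rep_sum act_simps)
  also have "\<dots> = tensor_sum (\<Delta> h) (\<lambda>q1 t. tensor_sum (\<Delta> t) (\<lambda>q2 y. \<psi> (actL q1 a) (actV (q2 * S y) w)))"
    by (rule comult_coassoc) (simp add: multi_simps)
  also have "\<dots> = tensor_sum (\<Delta> h) (\<lambda>q1 t. \<psi> (actL q1 a) (actV (scaleH (\<epsilon> t) 1) w))"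
    by (simp only: rep_tensor_sum[symmetric] act_tensor_sum_left[symmetric] antipode_right_sum)
  also have "\<dots> = tensor_sum (\<Delta> h) (\<lambda>q1 t. \<psi> (actL (scaleH (\<epsilon> t) q1) a) w)"
    by (simp add: act_simps)
  also have "\<dots> = \<psi> (actL (tensor_sum (\<Delta> h) (\<lambda>q1 t. scaleH (\<epsilon> t) q1)) a) w"
    by (rule tensor_sum_additive[symmetric]) (simp add: act_simps)
  finally show ?thesis by (simp add: counit_right_sum)
qed

text \<open>
  Since \<open>S(h\<^sub>1) h\<^sub>2 = \<epsilon>(h) 1\<close>, one has \<open>\<psi>(a) S(h) = S(h\<^sub>1) h\<^sub>2 \<psi>(a) S(h\<^sub>3)\<close>, and the last three factors are
  \<open>\<psi>(h\<^sub>2 a)\<close> by the previous lemma.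
\<close>

lemma antipode_rep_commute:
  "tensor_sum (\<Delta> h) (\<lambda>x y. actV (S x) (\<psi> (actL y a) w)) = \<psi> a (actV (S h) w)"
proof -
  have "\<psi> a (actV (S h) w) = \<psi> a (actV (S (tensor_sum (\<Delta> h) (\<lambda>x y. scaleH (\<epsilon> x) y))) w)"
    by (simp add: counit_left_sum)
  also have "\<dots> = tensor_sum (\<Delta> h) (\<lambda>x y. \<psi> a (actV (S (scaleH (\<epsilon> x) y)) w))"
    by (rule tensor_sum_additive) (simp add: multi_simps)
  also have "\<dots> = tensor_sum (\<Delta> h) (\<lambda>x y. actV (scaleH (\<epsilon> x) 1) (\<psi> a (actV (S y) w)))"
    by (simp add: multi_simps)
  also have "\<dots> = tensor_sum (\<Delta> h) (\<lambda>x y.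
      tensor_sum (\<Delta> x) (\<lambda>p q. actV (S p * q) (\<psi> a (actV (S y) w))))"
    by (simp only: antipode_left_sum[symmetric] act_tensor_sum_left)
  also have "\<dots> = tensor_sum (\<Delta> h) (\<lambda>p r.
      tensor_sum (\<Delta> r) (\<lambda>q y. actV (S p * q) (\<psi> a (actV (S y) w))))"
    by (rule comult_coassoc) (simp add: multi_simps)
  also have "\<dots> = tensor_sum (\<Delta> h) (\<lambda>p r. actV (S p) (\<psi> (actL r a) w))"
    by (simp only: act_simps(14) act_tensor_sum[symmetric] rep_smash_antipode)
  finally show ?thesis by simp
qed

definition average :: "'h \<Rightarrow> ('v \<Rightarrow> 'v) \<Rightarrow> 'v \<Rightarrow> 'v" where
  "average s p v = tensor_sum (\<Delta> s) (\<lambda>x y. actV (S x) (p (actV y v)))"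

context
  fixes p :: "'v \<Rightarrow> 'v"
  assumes linear_p: "Vector_Spaces.linear scaleV scaleV p"
begin

lemma p_simps: "p (v + w) = p v + p w" "p (scaleV c v) = scaleV c (p v)"
  using linear_p by (simp_all add: Vector_Spaces.linear_iff)

lemma linear_average: "Vector_Spaces.linear scaleV scaleV (average s p)"
  by (simp add: Vector_Spaces.linear_iff rep.V.vector_space_axioms average_def multi_simps p_simps)

lemma average_rep:
  assumes "\<And>a v. p (\<psi> a v) = \<psi> a (p v)"
  shows "average s p (\<psi> a v) = \<psi> a (average s p v)"
proof -
  have p_sum: "p (tensor_sum u \<beta>) = tensor_sum u (\<lambda>x y. p (\<beta> x y))"
    for u and \<beta> :: "'h \<Rightarrow> 'h \<Rightarrow> 'v"
    by (rule tensor_sum_additive) (simp add: p_simps)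
  have "average s p (\<psi> a v) = tensor_sum (\<Delta> s) (\<lambda>x r.
      tensor_sum (\<Delta> r) (\<lambda>y z. actV (S x) (\<psi> (actL y a) (p (actV z v)))))"
    by (simp add: average_def act_rep_sum p_sum act_tensor_sum assms)
  also have "\<dots> = tensor_sum (\<Delta> s) (\<lambda>r z.
      tensor_sum (\<Delta> r) (\<lambda>x y. actV (S x) (\<psi> (actL y a) (p (actV z v)))))"
    by (rule comult_coassoc[symmetric]) (simp add: multi_simps p_simps)
  also have "\<dots> = \<psi> a (average s p v)"
    by (simp add: antipode_rep_commute average_def rep_tensor_sum)
  finally show ?thesis .
qed

text \<open>
  The integral enters as \<open>t h = \<epsilon>(h) t\<close> with the second leg of \<open>h\<close>: writing \<open>S(t\<^sub>1) = h\<^sub>1 S(t\<^sub>1 h\<^sub>2)\<close>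
  up to the counit turns \<open>S(t\<^sub>1) p(t\<^sub>2 h v)\<close> into \<open>h\<^sub>1 S((t h\<^sub>2)\<^sub>1) p((t h\<^sub>2)\<^sub>2 v)\<close>.
\<close>

lemma average_act:
  assumes integral: "\<And>h. s * h = scaleH (\<epsilon> h) s"
  shows "average s p (actV h v) = actV h (average s p v)"
proof -
  define f where "f x y = tensor_sum (\<Delta> s) (\<lambda>s1 s2. actV (S (s1 * x)) (p (actV (s2 * y) v)))" for x y
  have f_simps: "f (x + x') y = f x y + f x' y" "f x (y + y') = f x y + f x y'"
    "f (scaleH c x) y = scaleV c (f x y)" "f x (scaleH c y) = scaleV c (f x y)" for x x' y y' c
    by (simp_all add: f_def multi_simps p_simps)
  have "average s p (actV h v) = f 1 h"
    by (simp add: average_def f_def act_simps)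
  also have "\<dots> = f 1 (tensor_sum (\<Delta> h) (\<lambda>x y. scaleH (\<epsilon> x) y))" by (simp add: counit_left_sum)
  also have "\<dots> = tensor_sum (\<Delta> h) (\<lambda>x y. scaleV (\<epsilon> x) (f 1 y))"
    by (subst tensor_sum_additive[where F = "f 1"]) (simp_all add: f_simps)
  also have "\<dots> = tensor_sum (\<Delta> h) (\<lambda>r y. tensor_sum (\<Delta> s) (\<lambda>s1 s2.
      actV (scaleH (\<epsilon> r) (S s1)) (p (actV (s2 * y) v))))"
    by (simp add: f_def multi_simps)
  also have "\<dots> = tensor_sum (\<Delta> h) (\<lambda>r y. tensor_sum (\<Delta> s) (\<lambda>s1 s2. tensor_sum (\<Delta> r) (\<lambda>h1 x.
      actV (h1 * S (s1 * x)) (p (actV (s2 * y) v)))))"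
    by (simp only: comult_antipode_absorb_left[symmetric] act_tensor_sum_left)
  also have "\<dots> = tensor_sum (\<Delta> h) (\<lambda>r y. tensor_sum (\<Delta> r) (\<lambda>h1 x. actV h1 (f x y)))"
    by (subst (2) tensor_sum_swap) (simp add: f_def act_tensor_sum act_simps)
  also have "\<dots> = tensor_sum (\<Delta> h) (\<lambda>h1 r. tensor_sum (\<Delta> r) (\<lambda>x y. actV h1 (f x y)))"
    by (rule comult_coassoc) (simp add: multi_simps f_simps)
  also have "\<dots> = tensor_sum (\<Delta> h) (\<lambda>h1 r. actV h1 (tensor_sum (\<Delta> r) (\<lambda>x y. f x y)))"
    by (simp add: act_tensor_sum)
  also have "\<dots> = tensor_sum (\<Delta> h) (\<lambda>h1 r. actV h1
      (tensor_sum (\<Delta> (s * r)) (\<lambda>a b. actV (S a) (p (actV b v)))))"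
    unfolding f_def by (subst comult_mult_sum, simp add: multi_simps p_simps, subst (2) tensor_sum_swap) simp
  also have "\<dots> = tensor_sum (\<Delta> h) (\<lambda>h1 r. actV (scaleH (\<epsilon> r) h1) (average s p v))"
    by (simp add: integral average_def multi_simps p_simps)
  also have "\<dots> = actV h (average s p v)"
    by (simp only: act_tensor_sum_left[symmetric] counit_right_sum)
  finally show ?thesis .
qed

end

lemma average_commuting_projection:
  assumes p: "commuting_projection scaleV (range \<psi>) W p"
    and W: "module_HL_submodule scaleV \<psi> actV W"
    and s: "\<epsilon> s = 1" "\<And>h. s * h = scaleH (\<epsilon> h) s"
  shows "commuting_projection scaleV (range \<psi> \<union> range actV) W (average s p)"
proof -
  have lin: "Vector_Spaces.linear scaleV scaleV p" and p_rep: "\<And>a v. p (\<psi> a v) = \<psi> a (p v)"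
    and pW: "\<And>v. p v \<in> W" "\<And>w. w \<in> W \<Longrightarrow> p w = w"
    using p by (auto simp: commuting_projection_def)
  have subW: "rep.V.subspace W" and actW: "\<And>h w. w \<in> W \<Longrightarrow> actV h w \<in> W"
    using W by (auto simp: module_HL_submodule_def L_submodule_def)
  have "average s p v \<in> W" for v
    unfolding average_def by (rule rep.V.tensor_sum_in_subspace[OF subW]) (simp add: actW pW)
  moreover have "average s p w = w" if "w \<in> W" for w
  proof -
    have "average s p w = tensor_sum (\<Delta> s) (\<lambda>x y. actV (S x * y) w)"
      by (simp add: average_def pW actW that act_simps)
    also have "\<dots> = w"
      by (simp only: act_tensor_sum_left[symmetric] antipode_left_sum s(1))
         (simp add: act_simps)
    finally show ?thesis .
  qed
  ultimately show ?thesis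
    using linear_average[OF lin] average_rep[OF lin p_rep] average_act[OF lin s(2)]
    by (auto simp: commuting_projection_def)
qed

lemma module_HL_submodule_iff_invariant:
  "module_HL_submodule scaleV \<psi> actV = invariant_subspace scaleV (range \<psi> \<union> range actV)"
  by (auto simp: fun_eq_iff module_HL_submodule_def L_submodule_def invariant_subspace_def)

lemma module_complete_reducibility:
  assumes "finite_dimensional scaleH" "finite_dimensional scaleV" "semisimple scaleH"
    and red: "completely_reducible (L_submodule scaleV \<psi>)"
  shows "completely_reducible (module_HL_submodule scaleV \<psi> actV)"
proof -
  obtain BH where BH: "finite_dimensional_vector_space scaleH BH"
    using assms(1) by (auto simp: finite_dimensional_def)
  obtain s where s: "\<epsilon> s = 1" "\<And>h. s * h = scaleH (\<epsilon> h) s"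
    using semisimple_imp_integral[OF BH assms(3)] by blast
  obtain BV where BV: "finite_dimensional_vector_space scaleV BV"
    using assms(2) by (auto simp: finite_dimensional_def)
  have lin: "Vector_Spaces.linear scaleV scaleV f" if "f \<in> range \<psi> \<union> range actV" for f
    using that by (auto simp: Vector_Spaces.linear_iff rep.V.vector_space_axioms act_simps)
  interpret L: operator_space scaleV BV "range \<psi>"
    using BV lin by (intro operator_space.intro operator_space_axioms.intro) auto
  interpret HL: operator_space scaleV BV "range \<psi> \<union> range actV"
    using BV lin by (intro operator_space.intro operator_space_axioms.intro) auto
  have red': "completely_reducible L.invariant"
    using red by (simp add: L_submodule_def[abs_def] invariant_subspace_def[abs_def])
  show ?thesis
    unfolding module_HL_submodule_iff_invariant
  proof (rule HL.projections_imp_completely_reducible)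
    fix W assume W: "HL.invariant W"
    then have "L.invariant W" by (auto simp: invariant_subspace_def)
    then obtain p where "commuting_projection scaleV (range \<psi>) W p"
      using L.completely_reducible_imp_projection[OF red'] by blast
    then show "\<exists>p. commuting_projection scaleV (range \<psi> \<union> range actV) W p"
      using average_commuting_projection s W by (metis module_HL_submodule_iff_invariant)
  qed
qed

end

section \<open>Coefficient operators of a comodule\<close>

text \<open>
  The action on a right comodule of the functional \<open>f\<close>, an element of the dual algebra:
  \<open>v \<mapsto> f(v\<^sub>1) v\<^sub>0\<close>.
\<close>

definition coefficient ::
  "('f \<Rightarrow> 'v::ab_group_add \<Rightarrow> 'v) \<Rightarrow> ('v \<Rightarrow> ('v \<times> 'h) list) \<Rightarrow> ('h \<Rightarrow> 'f) \<Rightarrow> 'v \<Rightarrow> 'v" where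
  "coefficient scaleV \<rho> f v = tensor_sum (\<rho> v) (\<lambda>w x. scaleV (f x) w)"

context right_comodule
begin

lemma coact_add:
  assumes "balanced scaleV scaleH \<beta>"
  shows "tensor_sum (\<rho> (v + w)) \<beta> = tensor_sum (\<rho> v) \<beta> + tensor_sum (\<rho> w) \<beta>"
  by (rule tensor_sum_linear_add[OF coact_linear assms])

lemma coact_scale:
  assumes "balanced scaleV scaleH \<beta>"
  shows "tensor_sum (\<rho> (scaleV c v)) \<beta> = tensor_sum (\<rho> v) (\<lambda>a b. \<beta> (scaleV c a) b)"
  by (rule tensor_sum_linear_scale[OF coact_linear assms])

lemma coact_coassoc_sum:
  assumes "balanced3 scaleV scaleH scaleH \<tau>"
  shows "tensor_sum (\<rho> v) (\<lambda>u y. tensor_sum (\<rho> u) (\<lambda>w x. \<tau> w x y)) =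
    tensor_sum (\<rho> v) (\<lambda>u h. tensor_sum (\<Delta> h) (\<lambda>x y. \<tau> u x y))"
  using tensor3_sum_eq[OF assms coact_coassoc[of v]]
  by (simp add: tensor_sum_concat) (simp add: tensor_sum_def split_def comp_def)

lemma coact_counit_sum: "tensor_sum (\<rho> v) (\<lambda>u h. scaleV (\<epsilon> h) u) = v"
  using coact_counit by (simp add: tensor_sum_def)

lemma coefficient_balanced:
  "Vector_Spaces.linear scaleH (*) f \<Longrightarrow> balanced scaleV scaleH (\<lambda>w x. scaleV (f x) w)"
  by (simp add: balanced_def Vector_Spaces.linear_iff V.scale_left_distrib V.scale_right_distrib mult.commute)

text \<open>
  A subcomodule is a submodule for the dual algebra. From right to left, the coefficients of \<open>\<rho> w\<close>
  along a finite basis of \<open>H\<close> are the entries of a representative of \<open>\<rho> w\<close>.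
\<close>

lemma subcomodule_iff_coefficients:
  assumes "finite_dimensional_vector_space scaleH B"
  shows "subcomodule scaleH scaleV \<rho> W \<longleftrightarrow> V.subspace W \<and>
    (\<forall>f. Vector_Spaces.linear scaleH (*) f \<longrightarrow> (\<forall>w\<in>W. coefficient scaleV \<rho> f w \<in> W))"
proof (intro iffI conjI allI impI ballI)
  assume sub: "subcomodule scaleH scaleV \<rho> W"
  then show W: "V.subspace W" by (simp add: subcomodule_def)
  fix f w assume f: "Vector_Spaces.linear scaleH (*) f" and w: "w \<in> W"
  obtain u where u: "set u \<subseteq> W \<times> UNIV" "tensor_eq scaleV scaleH (\<rho> w) u"
    using sub w by (auto simp: subcomodule_def)
  show "coefficient scaleV \<rho> f w \<in> W"
    unfolding coefficient_def tensor_sum_eq[OF coefficient_balanced[OF f] u(2)]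
    by (rule V.tensor_sum_in_subspace[OF W]) (use u(1) V.subspace_scale[OF W] in auto)
next
  interpret H: finite_dimensional_vector_space scaleH B by fact
  assume *: "V.subspace W \<and>
    (\<forall>f. Vector_Spaces.linear scaleH (*) f \<longrightarrow> (\<forall>w\<in>W. coefficient scaleV \<rho> f w \<in> W))"
  obtain bs where bs: "set bs = B" "distinct bs" using finite_distinct_list[OF H.finite_Basis] by blast
  have expand: "h = (\<Sum>b\<leftarrow>bs. scaleH (representation B h b) b)" for h
    using sum_representation_eq[OF H.independent_Basis, of h B] H.finite_Basis H.span_Basis bs
    by (simp add: sum_list_distinct_conv_sum_set)
  show "subcomodule scaleH scaleV \<rho> W"
    unfolding subcomodule_def
  proof (intro conjI ballI)
    show "V.subspace W" using * by simp
    fix w assume w: "w \<in> W"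
    have "coefficient scaleV \<rho> (\<lambda>h. representation B h b) w \<in> W" for b
      using * w linear_representation[OF H.independent_Basis H.span_Basis, of b] by blast
    then show "\<exists>u. set u \<subseteq> W \<times> UNIV \<and> tensor_eq scaleV scaleH (\<rho> w) u"
      using tensor_eq_basis[OF V.vector_space_axioms vector_space_axioms expand, of "\<rho> w"]
      by (intro exI[of _ "map (\<lambda>b. (coefficient scaleV \<rho> (\<lambda>h. representation B h b) w, b)) bs"])
         (auto simp: coefficient_def)
  qed
qed

end

section \<open>Averaging over a cointegral: the comodule case\<close>

context comodule_HL_module
begin

lemma rep_simps:
  "\<psi> (a + b) v = \<psi> a v + \<psi> b v" "\<psi> a (v + w) = \<psi> a v + \<psi> a w"
  "\<psi> (scaleL c a) v = scaleV c (\<psi> a v)" "\<psi> a (scaleV c v) = scaleV c (\<psi> a v)"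
  using rep.rep_bilinear by (auto simp: bilinear_map_def Vector_Spaces.linear_iff)

lemmas multi_simps = multilinear_simps rep_simps rep.V.tensor_sum_scale
  rep.V.scale_right_distrib rep.V.scale_left_distrib
  rep.V.tensor_sum_scale_mult V.coact_add V.coact_scale L.coact_add L.coact_scale

lemma rep_tensor_sum: "\<psi> a (tensor_sum u \<beta>) = tensor_sum u (\<lambda>x y. \<psi> a (\<beta> x y))"
  by (rule tensor_sum_additive) (simp add: rep_simps)

lemma rep_tensor_sum_left: "\<psi> (tensor_sum u \<beta>) v = tensor_sum u (\<lambda>x y. \<psi> (\<beta> x y) v)"
  by (rule tensor_sum_additive) (simp add: rep_simps)

lemma coact_rep_sum:
  assumes "balanced scaleV scaleH \<beta>"
  shows "tensor_sum (\<rho>V (\<psi> a v)) \<beta> =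
    tensor_sum (\<rho>L a) (\<lambda>a0 a1. tensor_sum (\<rho>V v) (\<lambda>v0 v1. \<beta> (\<psi> a0 v0) (a1 * v1)))"
  using tensor_sum_eq[OF assms coact_rep[of a v]]
  by (simp add: tensor_sum_concat_tensor tensor_sum_map)

definition average :: "('h \<Rightarrow> 'f) \<Rightarrow> ('v \<Rightarrow> 'v) \<Rightarrow> 'v \<Rightarrow> 'v" where
  "average l p v = tensor_sum (\<rho>V v) (\<lambda>v0 v1.
     tensor_sum (\<rho>V (p v0)) (\<lambda>w x. scaleV (l (S x * v1)) w))"

context
  fixes p :: "'v \<Rightarrow> 'v" and l :: "'h \<Rightarrow> 'f"
  assumes linear_p: "Vector_Spaces.linear scaleV scaleV p"
    and linear_l: "Vector_Spaces.linear scaleH (*) l"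
begin

lemma pl_simps: "p (v + w) = p v + p w" "p (scaleV c v) = scaleV c (p v)"
  "l (x + y) = l x + l y" "l (scaleH c x) = c * l x"
  using linear_p linear_l by (simp_all add: Vector_Spaces.linear_iff)

lemma linear_average: "Vector_Spaces.linear scaleV scaleV (average l p)"
  by (simp add: Vector_Spaces.linear_iff rep.V.vector_space_axioms average_def multi_simps pl_simps)

lemma average_simps:
  "average l p (v + w) = average l p v + average l p w"
  "average l p (scaleV c v) = scaleV c (average l p v)"
  using linear_average by (simp_all add: Vector_Spaces.linear_iff)

text \<open>
  Both \<open>\<psi>(a)\<close> inside \<open>\<rho>(p(v\<^sub>0))\<close> and the one in front contribute a factor from \<open>H\<close>, so \<open>l\<close> is evaluated
  at \<open>S(a\<^sub>1 x) a\<^sub>2 v\<^sub>1\<close>, where \<open>x = p(v\<^sub>0)\<^sub>1\<close>; by \<open>comult_antipode_absorb_right\<close> the two cancel.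
\<close>

lemma average_rep:
  assumes p_rep: "\<And>a v. p (\<psi> a v) = \<psi> a (p v)"
  shows "average l p (\<psi> a v) = \<psi> a (average l p v)"
proof -
  define K where "K b0 b1 a1 = tensor_sum (\<rho>V v) (\<lambda>v0 v1. tensor_sum (\<rho>V (p v0)) (\<lambda>w x.
    scaleV (l (S (b1 * x) * a1 * v1)) (\<psi> b0 w)))" for b0 b1 a1
  have K_simps: "K (b + b') x y = K b x y + K b' x y" "K b (x + x') y = K b x y + K b x' y"
    "K b x (y + y') = K b x y + K b x y'" "K (scaleL c b) x y = scaleV c (K b x y)"
    "K b (scaleH c x) y = scaleV c (K b x y)" "K b x (scaleH c y) = scaleV c (K b x y)"
    for b b' x x' y y' c
    by (simp_all add: K_def multi_simps pl_simps)
  have K_comult: "tensor_sum (\<Delta> h) (\<lambda>b1 a1. K a0 b1 a1) = \<psi> (scaleL (\<epsilon> h) a0) (average l p v)" for h a0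
  proof -
    have "tensor_sum (\<Delta> h) (\<lambda>b1 a1. l (S (b1 * x) * a1 * v1)) = \<epsilon> h * l (S x * v1)" for x v1
    proof -
      have "tensor_sum (\<Delta> h) (\<lambda>b1 a1. l (S (b1 * x) * a1 * v1)) =
          l (tensor_sum (\<Delta> h) (\<lambda>b1 a1. S (b1 * x) * a1) * v1)"
        by (rule tensor_sum_additive[symmetric]) (simp add: pl_simps distrib_right)
      then show ?thesis by (simp add: comult_antipode_absorb_right scale_mult_left pl_simps)
    qed
    then have "tensor_sum (\<rho>V v) (\<lambda>v0 v1. tensor_sum (\<rho>V (p v0)) (\<lambda>w x. tensor_sum (\<Delta> h) (\<lambda>b1 a1.
        scaleV (l (S (b1 * x) * a1 * v1)) (\<psi> a0 w)))) = \<psi> (scaleL (\<epsilon> h) a0) (average l p v)"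
      by (simp add: rep.V.tensor_sum_scale_left average_def rep_tensor_sum rep_simps
          rep.V.tensor_sum_scale[symmetric] mult.commute)
    then show ?thesis
      unfolding K_def by (subst tensor_sum_swap, subst (2) tensor_sum_swap)
  qed
  have "average l p (\<psi> a v) = tensor_sum (\<rho>L a) (\<lambda>a0 a1. tensor_sum (\<rho>V v) (\<lambda>v0 v1.
      tensor_sum (\<rho>L a0) (\<lambda>b0 b1. tensor_sum (\<rho>V (p v0)) (\<lambda>w x.
        scaleV (l (S (b1 * x) * a1 * v1)) (\<psi> b0 w)))))"
    by (simp add: average_def coact_rep_sum p_rep multi_simps pl_simps mult.assoc)
  also have "\<dots> = tensor_sum (\<rho>L a) (\<lambda>a0 a1. tensor_sum (\<rho>L a0) (\<lambda>b0 b1. K b0 b1 a1))"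
    unfolding K_def by (subst (2) tensor_sum_swap) simp
  also have "\<dots> = tensor_sum (\<rho>L a) (\<lambda>a0 h. tensor_sum (\<Delta> h) (\<lambda>b1 a1. K a0 b1 a1))"
    by (rule L.coact_coassoc_sum) (simp add: multi_simps K_simps)
  also have "\<dots> = \<psi> a (average l p v)"
    by (simp only: K_comult rep_tensor_sum_left[symmetric] L.coact_counit_sum)
  finally show ?thesis .
qed

text \<open>
  With \<open>w = p(v\<^sub>0)\<^sub>0\<close>, \<open>x = p(v\<^sub>0)\<^sub>1\<close> and \<open>y = v\<^sub>1\<close>, both sides have the form \<open>f(k) w\<close>: the left one with
  \<open>k = l(S(x) y\<^sub>1) y\<^sub>2\<close>, the right one with \<open>k = l(S(x\<^sub>2) y) x\<^sub>1\<close>, which agree by \<open>cointegral_antipode\<close>.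
\<close>

lemma average_coefficient:
  assumes l: "\<And>h. tensor_sum (\<Delta> h) (\<lambda>x y. scaleH (l x) y) = scaleH (l h) 1"
    and f: "Vector_Spaces.linear scaleH (*) f"
  shows "average l p (coefficient scaleV \<rho>V f v) = coefficient scaleV \<rho>V f (average l p v)"
proof -
  have f_simps: "f (x + y) = f x + f y" "f (scaleH c x) = c * f x" for x y c
    using f by (simp_all add: Vector_Spaces.linear_iff)
  have f_sum: "f (tensor_sum u \<beta>) = tensor_sum u (\<lambda>x y. f (\<beta> x y))" for u and \<beta> :: "'h \<Rightarrow> 'h \<Rightarrow> 'h"
    by (rule tensor_sum_additive) (simp add: f_simps)
  let ?c = "coefficient scaleV \<rho>V f"
  have c_sum: "?c (tensor_sum u \<beta>) = tensor_sum u (\<lambda>x y. ?c (\<beta> x y))" for u and \<beta> :: "'v \<Rightarrow> 'h \<Rightarrow> 'v"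
    by (rule tensor_sum_additive) (simp add: coefficient_def multi_simps f_simps)
  have "average l p (?c v) = tensor_sum (\<rho>V v) (\<lambda>u k. scaleV (f k) (average l p u))"
    unfolding coefficient_def by (subst tensor_sum_additive[where F = "average l p"])
      (simp_all add: average_simps)
  also have "\<dots> = tensor_sum (\<rho>V v) (\<lambda>u k. tensor_sum (\<rho>V u) (\<lambda>v0 y1.
      tensor_sum (\<rho>V (p v0)) (\<lambda>w x. scaleV (f (scaleH (l (S x * y1)) k)) w)))"
    by (simp add: average_def rep.V.tensor_sum_scale[symmetric] f_simps mult.commute)
  also have "\<dots> = tensor_sum (\<rho>V v) (\<lambda>v0 v1. tensor_sum (\<Delta> v1) (\<lambda>y1 k.
      tensor_sum (\<rho>V (p v0)) (\<lambda>w x. scaleV (f (scaleH (l (S x * y1)) k)) w)))"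
    by (rule V.coact_coassoc_sum) (simp add: multi_simps pl_simps f_simps mult.left_commute)
  also have "\<dots> = tensor_sum (\<rho>V v) (\<lambda>v0 v1. tensor_sum (\<rho>V (p v0)) (\<lambda>w x.
      scaleV (f (tensor_sum (\<Delta> v1) (\<lambda>y1 y2. scaleH (l (S x * y1)) y2))) w))"
    by (intro tensor_sum_cong, subst tensor_sum_swap) (simp add: f_sum rep.V.tensor_sum_scale_left)
  also have "\<dots> = tensor_sum (\<rho>V v) (\<lambda>v0 v1. tensor_sum (\<rho>V (p v0)) (\<lambda>w h.
      tensor_sum (\<Delta> h) (\<lambda>x1 x2. scaleV (f (scaleH (l (S x2 * v1)) x1)) w)))"
    by (simp add: cointegral_antipode[OF linear_l l, symmetric] f_sum rep.V.tensor_sum_scale_left)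
  also have "\<dots> = tensor_sum (\<rho>V v) (\<lambda>v0 v1. tensor_sum (\<rho>V (p v0)) (\<lambda>u x2.
      tensor_sum (\<rho>V u) (\<lambda>w x1. scaleV (f (scaleH (l (S x2 * v1)) x1)) w)))"
    by (intro tensor_sum_cong V.coact_coassoc_sum[symmetric])
       (simp add: multi_simps pl_simps f_simps mult.left_commute)
  also have "\<dots> = tensor_sum (\<rho>V v) (\<lambda>v0 v1. tensor_sum (\<rho>V (p v0)) (\<lambda>u x2.
      ?c (scaleV (l (S x2 * v1)) u)))"
    by (simp add: coefficient_def multi_simps f_simps)
  also have "\<dots> = ?c (average l p v)"
    by (simp add: average_def c_sum)
  finally show ?thesis .
qed

end

lemma comodule_HL_submodule_iff_invariant:
  assumes "finite_dimensional_vector_space scaleH B"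
  shows "comodule_HL_submodule scaleH scaleV \<psi> \<rho>V = invariant_subspace scaleV
    (range \<psi> \<union> coefficient scaleV \<rho>V ` {f. Vector_Spaces.linear scaleH (*) f})"
  by (auto simp: fun_eq_iff comodule_HL_submodule_def L_submodule_def invariant_subspace_def
      V.subcomodule_iff_coefficients[OF assms])

lemma average_commuting_projection:
  fixes l :: "'h \<Rightarrow> 'f"
  assumes B: "finite_dimensional_vector_space scaleH B"
    and p: "commuting_projection scaleV (range \<psi>) W p"
    and W: "comodule_HL_submodule scaleH scaleV \<psi> \<rho>V W"
    and lin_l: "Vector_Spaces.linear scaleH (*) l" and l1: "l 1 = 1"
    and l: "\<And>h. tensor_sum (\<Delta> h) (\<lambda>x y. scaleH (l x) y) = scaleH (l h) 1"
  shows "commuting_projection scaleV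
    (range \<psi> \<union> coefficient scaleV \<rho>V ` {f. Vector_Spaces.linear scaleH (*) f}) W (average l p)"
proof -
  have lin: "Vector_Spaces.linear scaleV scaleV p" and p_rep: "\<And>a v. p (\<psi> a v) = \<psi> a (p v)"
    and pW: "\<And>v. p v \<in> W" "\<And>w. w \<in> W \<Longrightarrow> p w = w"
    using p by (auto simp: commuting_projection_def)
  note pl = pl_simps[OF lin lin_l]
  have subW: "rep.V.subspace W" and sub: "subcomodule scaleH scaleV \<rho>V W"
    using W by (auto simp: comodule_HL_submodule_def subcomodule_def)
  have "average l p v \<in> W" for v
    unfolding average_def
  proof (rule rep.V.tensor_sum_in_subspace[OF subW])
    fix v0 v1
    have "Vector_Spaces.linear scaleH (*) (\<lambda>x. l (S x * v1))"
      using lin_l by (simp add: Vector_Spaces.linear_iff multi_simps)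
    then show "tensor_sum (\<rho>V (p v0)) (\<lambda>w x. scaleV (l (S x * v1)) w) \<in> W"
      using sub pW V.subcomodule_iff_coefficients[OF B] unfolding coefficient_def by blast
  qed
  moreover have "average l p w = w" if w: "w \<in> W" for w
  proof -
    obtain u where u: "set u \<subseteq> W \<times> UNIV" "tensor_eq scaleV scaleH (\<rho>V w) u"
      using sub w by (auto simp: subcomodule_def)
    have "average l p w = tensor_sum u (\<lambda>v0 v1. tensor_sum (\<rho>V (p v0)) (\<lambda>w x. scaleV (l (S x * v1)) w))"
      unfolding average_def by (rule tensor_sum_eq[OF _ u(2)]) (simp add: multi_simps pl)
    also have "\<dots> = tensor_sum u (\<lambda>v0 v1. tensor_sum (\<rho>V v0) (\<lambda>w x. scaleV (l (S x * v1)) w))"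
      by (rule tensor_sum_cong) (use u(1) pW in auto)
    also have "\<dots> = tensor_sum (\<rho>V w) (\<lambda>v0 v1. tensor_sum (\<rho>V v0) (\<lambda>w x. scaleV (l (S x * v1)) w))"
      by (rule tensor_sum_eq[OF _ u(2), symmetric]) (simp add: multi_simps pl)
    also have "\<dots> = tensor_sum (\<rho>V w) (\<lambda>w h. tensor_sum (\<Delta> h) (\<lambda>x y. scaleV (l (S x * y)) w))"
      by (rule V.coact_coassoc_sum) (simp add: multi_simps pl)
    also have "\<dots> = tensor_sum (\<rho>V w) (\<lambda>w h. scaleV (\<epsilon> h) w)"
    proof (rule tensor_sum_cong)
      fix w h
      have "tensor_sum (\<Delta> h) (\<lambda>x y. l (S x * y)) = l (tensor_sum (\<Delta> h) (\<lambda>x y. S x * y))"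
        by (rule tensor_sum_additive[symmetric]) (simp add: pl)
      then show "tensor_sum (\<Delta> h) (\<lambda>x y. scaleV (l (S x * y)) w) = scaleV (\<epsilon> h) w"
        by (simp add: rep.V.tensor_sum_scale_left antipode_left_sum pl l1)
    qed
    finally show ?thesis by (simp add: V.coact_counit_sum)
  qed
  ultimately show ?thesis
    using linear_average[OF lin lin_l] average_rep[OF lin lin_l p_rep] average_coefficient[OF lin lin_l l]
    by (auto simp: commuting_projection_def)
qed

lemma comodule_complete_reducibility:
  assumes "finite_dimensional scaleH" "finite_dimensional scaleV" "cosemisimple scaleH \<Delta>"
    and red: "completely_reducible (L_submodule scaleV \<psi>)"
  shows "completely_reducible (comodule_HL_submodule scaleH scaleV \<psi> \<rho>V)"
proof -
  obtain BH where BH: "finite_dimensional_vector_space scaleH BH"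
    using assms(1) by (auto simp: finite_dimensional_def)
  obtain l where l: "Vector_Spaces.linear scaleH (*) l" "l 1 = 1"
    "\<And>h. tensor_sum (\<Delta> h) (\<lambda>x y. scaleH (l x) y) = scaleH (l h) 1"
    using cosemisimple_imp_cointegral[OF assms(3)] by blast
  obtain BV where BV: "finite_dimensional_vector_space scaleV BV"
    using assms(2) by (auto simp: finite_dimensional_def)
  let ?C = "coefficient scaleV \<rho>V ` {f. Vector_Spaces.linear scaleH (*) f}"
  have lin: "Vector_Spaces.linear scaleV scaleV t" if "t \<in> range \<psi> \<union> ?C" for t
    using that
    by (auto simp: Vector_Spaces.linear_iff rep.V.vector_space_axioms coefficient_def multi_simps)
  interpret L: operator_space scaleV BV "range \<psi>"
    using BV lin by (intro operator_space.intro operator_space_axioms.intro) auto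
  interpret HL: operator_space scaleV BV "range \<psi> \<union> ?C"
    using BV lin by (intro operator_space.intro operator_space_axioms.intro) auto
  have red': "completely_reducible L.invariant"
    using red by (simp add: L_submodule_def[abs_def] invariant_subspace_def[abs_def])
  show ?thesis
    unfolding comodule_HL_submodule_iff_invariant[OF BH]
  proof (rule HL.projections_imp_completely_reducible)
    fix W assume W: "HL.invariant W"
    then have "L.invariant W" by (auto simp: invariant_subspace_def)
    then obtain p where "commuting_projection scaleV (range \<psi>) W p"
      using L.completely_reducible_imp_projection[OF red'] by blast
    then show "\<exists>p. commuting_projection scaleV (range \<psi> \<union> ?C) W p"
      using average_commuting_projection[OF BH _ _ l] W comodule_HL_submodule_iff_invariant[OF BH]
      by metis
  qed
qed

end

section \<open>Decomposition into irreducible submodules\<close>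

theorem theorem10:
  fixes scaleH :: "'f::field_char_0 \<Rightarrow> 'h::ring_1 \<Rightarrow> 'h"
    and \<Delta> :: "'h \<Rightarrow> ('h \<times> 'h) list"
    and \<epsilon> :: "'h \<Rightarrow> 'f"
    and S :: "'h \<Rightarrow> 'h"
    and scaleL :: "'f \<Rightarrow> 'l::ab_group_add \<Rightarrow> 'l"
    and br :: "'l \<Rightarrow> 'l \<Rightarrow> 'l"
    and scaleV :: "'f \<Rightarrow> 'v::ab_group_add \<Rightarrow> 'v"
    and \<psi> :: "'l \<Rightarrow> 'v \<Rightarrow> 'v"
  assumes "hopf_algebra scaleH \<Delta> \<epsilon> S"
    and "finite_dimensional scaleH"
    and "lie_representation scaleL br scaleV \<psi>"
    and "finite_dimensional scaleV"
    and "completely_reducible (L_submodule scaleV \<psi>)"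
  shows "(\<forall>actL actV.
            semisimple scaleH \<and>
            H_module_lie_algebra scaleH \<Delta> \<epsilon> S scaleL br actL \<and>
            module_HL_module scaleH \<Delta> \<epsilon> S scaleL br actL scaleV \<psi> actV \<longrightarrow>
            (\<exists>s V. (\<forall>i\<in>{1..s}. irreducible_sub (module_HL_submodule scaleV \<psi> actV) (V i)) \<and>
                   direct_sum_decomposition s V)) \<and>
         (\<forall>\<rho>L \<rho>V.
            cosemisimple scaleH \<Delta> \<and>
            H_comodule_lie_algebra scaleH \<Delta> \<epsilon> S scaleL br \<rho>L \<and>
            comodule_HL_module scaleH \<Delta> \<epsilon> S scaleL br \<rho>L scaleV \<psi> \<rho>V \<longrightarrow>
            (\<exists>s V. (\<forall>i\<in>{1..s}. irreducible_sub (comodule_HL_submodule scaleH scaleV \<psi> \<rho>V) (V i)) \<and>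
                   direct_sum_decomposition s V))"
proof (intro conjI allI impI; elim conjE)
  fix actL actV
  assume "semisimple scaleH" and "module_HL_module scaleH \<Delta> \<epsilon> S scaleL br actL scaleV \<psi> actV"
  then have "completely_reducible (module_HL_submodule scaleV \<psi> actV)"
    using module_HL_module.module_complete_reducibility assms(2,4,5) by blast
  then show "\<exists>s V. (\<forall>i\<in>{1..s}. irreducible_sub (module_HL_submodule scaleV \<psi> actV) (V i)) \<and>
      direct_sum_decomposition s V"
    by (simp only: completely_reducible_def)
next
  fix \<rho>L \<rho>V
  assume "cosemisimple scaleH \<Delta>"
    and "comodule_HL_module scaleH \<Delta> \<epsilon> S scaleL br \<rho>L scaleV \<psi> \<rho>V"
  then have "completely_reducible (comodule_HL_submodule scaleH scaleV \<psi> \<rho>V)"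
    using comodule_HL_module.comodule_complete_reducibility assms(2,4,5) by blast
  then show "\<exists>s V. (\<forall>i\<in>{1..s}. irreducible_sub (comodule_HL_submodule scaleH scaleV \<psi> \<rho>V) (V i)) \<and>
      direct_sum_decomposition s V"
    by (simp only: completely_reducible_def)
qed

end
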